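(* Let $q\in[0,1)$ and $\alpha,\beta>0$ be fixed, and let $u=\frac{1-q}{\alpha}-1$, $v=\frac{1-q}{\beta}-1$. For each $N$ let $I=\{a,\dots,b\}\subseteq\{1,\dots,N\}$ with $a=a(N)$, $b=b(N)$ be an interval with $\min(a,N-b)\gg 1$. (i) If $uv\le 1$ and $u>\max(1,v)$ (low density phase, fan region), then $$\lim_{N\to\infty}\left\|\mu_I-\mathrm{Ber}_I\left(\tfrac{\alpha}{1-q}\right)\right\|_{\mathrm{TV}}=0 .$$ (ii) If $uv\le 1$ and $v>\max(1,u)$ (high density phase, fan region), then $$\lim_{N\to\infty}\left\|\mu_I-\mathrm{Ber}_I\left(1-\tfrac{\beta}{1-q}\right)\right\|_{\mathrm{TV}}=0 .$$
   Context: The open ASEP with parameters $(q,\alpha,\beta)$ on $\{1,\dots,N\}$ is the continuous-time Markov chain on $\Omega_N=\{0,1\}^N$ with generator $$\mathcal{L}f(\eta)=\sum_{x=1}^{N-1}\big(\eta(x)(1-\eta(x+1))+q\,\eta(x+1)(1-\eta(x))\big)[f(\eta^{x,x+1})-f(\eta)]+\alpha(1-\eta(1))[f(\eta^1)-f(\eta)]+\beta\eta(N)[f(\eta^N)-f(\eta)],$$ where $\eta^{x,y}$ is $\eta$ with the values at $x$ and $y$ swapped and $\eta^{w}$ is $\eta$ with the value at $w$ flipped. It has a unique stationary distribution $\mu=\mu^{N,q,\alpha,\beta}$. For an interval $I$, $\mu_I$ denotes the projection (marginal) of $\mu$ onto the coordinates in $I$, viewed as a probability measure on $\{0,1\}^{|I|}$,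 and $\mathrm{Ber}_I(\rho)$ denotes the Bernoulli-$\rho$ product measure on $\{0,1\}^{|I|}$. $\|\nu-\nu'\|_{\mathrm{TV}}=\frac12\sum_x|\nu(x)-\nu'(x)|$. For functions $f,g$ of $N$, $f\gg g$ means $\liminf_{N\to\infty}f(N)/g(N)=\infty$. *)

theory Defs
  imports "HOL-Probability.Probability"
begin

section \<open>Configurations\<close>

text \<open>
  A configuration on a set \<open>A\<close> of sites is a function \<open>nat \<Rightarrow> bool\<close> (\<open>True\<close> = occupied) that takes
  the fixed dummy value \<open>False\<close> off \<open>A\<close>; these functions are in bijection with \<open>{0,1}\<^sup>A\<close>, and they
  are the carrier of the library's \<^const>\<open>Pi_pmf\<close> with default value \<open>False\<close>.
\<close>

definition configs :: "nat set \<Rightarrow> (nat \<Rightarrow> bool) set" where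
  "configs A = PiE_dflt A False (\<lambda>_. UNIV)"

definition swap_sites :: "nat \<Rightarrow> nat \<Rightarrow> (nat \<Rightarrow> bool) \<Rightarrow> (nat \<Rightarrow> bool)" where
  "swap_sites x y \<eta> = \<eta>(x := \<eta> y, y := \<eta> x)"

definition flip_site :: "nat \<Rightarrow> (nat \<Rightarrow> bool) \<Rightarrow> (nat \<Rightarrow> bool)" where
  "flip_site w \<eta> = \<eta>(w := \<not> \<eta> w)"

definition occ :: "(nat \<Rightarrow> bool) \<Rightarrow> nat \<Rightarrow> real" where
  "occ \<eta> x = of_bool (\<eta> x)"


section \<open>The open ASEP\<close>

definition asep_gen ::
  "nat \<Rightarrow> real \<Rightarrow> real \<Rightarrow> real \<Rightarrow> ((nat \<Rightarrow> bool) \<Rightarrow> real) \<Rightarrow> (nat \<Rightarrow> bool) \<Rightarrow> real" where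
  "asep_gen N q \<alpha> \<beta> f \<eta> =
     (\<Sum>x\<in>{1..<N}. (occ \<eta> x * (1 - occ \<eta> (x + 1)) + q * occ \<eta> (x + 1) * (1 - occ \<eta> x))
                    * (f (swap_sites x (x + 1) \<eta>) - f \<eta>))
     + \<alpha> * (1 - occ \<eta> 1) * (f (flip_site 1 \<eta>) - f \<eta>)
     + \<beta> * occ \<eta> N * (f (flip_site N \<eta>) - f \<eta>)"

text \<open>
  The transition semigroup of the chain is the exponential of \<open>t\<close> times its generator; the series
  converges for every \<open>t\<close> because the state space is finite (see \<open>summable_asep_semigroup\<close>).
\<close>

definition asep_semigroup ::
  "nat \<Rightarrow> real \<Rightarrow> real \<Rightarrow> real \<Rightarrow> real \<Rightarrow> ((nat \<Rightarrow> bool) \<Rightarrow> real) \<Rightarrow> (nat \<Rightarrow> bool) \<Rightarrow> real" where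
  "asep_semigroup N q \<alpha> \<beta> t f \<eta> = (\<Sum>n. t ^ n / fact n * (asep_gen N q \<alpha> \<beta> ^^ n) f \<eta>)"

definition asep_stationary ::
  "nat \<Rightarrow> real \<Rightarrow> real \<Rightarrow> real \<Rightarrow> (nat \<Rightarrow> bool) pmf \<Rightarrow> bool" where
  "asep_stationary N q \<alpha> \<beta> \<mu> \<longleftrightarrow>
     set_pmf \<mu> \<subseteq> configs {1..N} \<and>
     (\<forall>t\<ge>0. \<forall>f. measure_pmf.expectation \<mu> (asep_semigroup N q \<alpha> \<beta> t f)
               = measure_pmf.expectation \<mu> f)"


section \<open>Marginals, product measures, total variation\<close>

definition marginal :: "nat set \<Rightarrow> (nat \<Rightarrow> bool) pmf \<Rightarrow> (nat \<Rightarrow> bool) pmf" where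
  "marginal I \<mu> = map_pmf (\<lambda>\<eta> x. if x \<in> I then \<eta> x else False) \<mu>"

text \<open>
  Pitfall: for \<open>\<rho> \<notin> {0..1}\<close>, \<^const>\<open>bernoulli_pmf\<close> clamps its parameter to \<open>{0..1}\<close>.
\<close>

definition Ber :: "nat set \<Rightarrow> real \<Rightarrow> (nat \<Rightarrow> bool) pmf" where
  "Ber I \<rho> = Pi_pmf I False (\<lambda>_. bernoulli_pmf \<rho>)"

text \<open>Total variation distance of two probability measures carried by the finite set \<open>X\<close>.\<close>

definition tv_dist :: "'a set \<Rightarrow> 'a pmf \<Rightarrow> 'a pmf \<Rightarrow> real" where
  "tv_dist X \<nu> \<nu>' = 1 / 2 * (\<Sum>x\<in>X. \<bar>pmf \<nu> x - pmf \<nu>' x\<bar>)"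


section \<open>Asymptotic comparison\<close>

definition much_greater :: "(nat \<Rightarrow> real) \<Rightarrow> (nat \<Rightarrow> real) \<Rightarrow> bool" where
  "much_greater f g \<longleftrightarrow> liminf (\<lambda>N. ereal (f N / g N)) = \<infinity>"


section \<open>Generator criterion for stationarity\<close>

lemma finite_configs: "finite A \<Longrightarrow> finite (configs A)"
  unfolding configs_def by (rule finite_PiE_dflt) auto

lemma swap_sites_configs:
  "\<eta> \<in> configs A \<Longrightarrow> x \<in> A \<Longrightarrow> y \<in> A \<Longrightarrow> swap_sites x y \<eta> \<in> configs A"
  by (auto simp: configs_def PiE_dflt_def swap_sites_def)

lemma flip_site_configs: "\<eta> \<in> configs A \<Longrightarrow> w \<in> A \<Longrightarrow> flip_site w \<eta> \<in> configs A"
  by (auto simp: configs_def PiE_dflt_def flip_site_def)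

lemma asep_gen_bound:
  assumes N: "N \<ge> 1" and B: "\<And>\<eta>. \<eta> \<in> configs {1..N} \<Longrightarrow> \<bar>f \<eta>\<bar> \<le> B"
    and eta: "\<eta> \<in> configs {1..N}"
  shows "\<bar>asep_gen N q \<alpha> \<beta> f \<eta>\<bar> \<le> 2 * (real N * (1 + \<bar>q\<bar>) + \<bar>\<alpha>\<bar> + \<bar>\<beta>\<bar>) * B"
proof -
  have B0: "0 \<le> B" using B[OF eta] by linarith
  have D: "\<bar>f \<zeta> - f \<eta>\<bar> \<le> 2 * B" if "\<zeta> \<in> configs {1..N}" for \<zeta>
    using B[OF that] B[OF eta] by linarith
  let ?r = "\<lambda>x. occ \<eta> x * (1 - occ \<eta> (x + 1)) + q * occ \<eta> (x + 1) * (1 - occ \<eta> x)"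
  have r: "\<bar>?r x\<bar> \<le> 1 + \<bar>q\<bar>" for x
    by (auto simp: occ_def)
  have T: "\<bar>?r x * (f (swap_sites x (x + 1) \<eta>) - f \<eta>)\<bar> \<le> (1 + \<bar>q\<bar>) * (2 * B)"
    if "x \<in> {1..<N}" for x
    unfolding abs_mult
    by (rule mult_mono[OF r D]) (use that eta in \<open>auto intro!: swap_sites_configs\<close>)
  have "\<bar>\<Sum>x\<in>{1..<N}. ?r x * (f (swap_sites x (x + 1) \<eta>) - f \<eta>)\<bar>
          \<le> (\<Sum>x\<in>{1..<N}. (1 + \<bar>q\<bar>) * (2 * B))"
    by (rule order_trans[OF sum_abs sum_mono[OF T]])
  also have "\<dots> = real (N - 1) * ((1 + \<bar>q\<bar>) * (2 * B))" by simp
  also have "\<dots> \<le> real N * ((1 + \<bar>q\<bar>) * (2 * B))"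
    by (rule mult_right_mono) (use B0 in auto)
  finally have 1: "\<bar>\<Sum>x\<in>{1..<N}. ?r x * (f (swap_sites x (x + 1) \<eta>) - f \<eta>)\<bar>
          \<le> real N * ((1 + \<bar>q\<bar>) * (2 * B))" .
  have 2: "\<bar>\<alpha> * (1 - occ \<eta> 1) * (f (flip_site 1 \<eta>) - f \<eta>)\<bar> \<le> \<bar>\<alpha>\<bar> * (2 * B)"
    unfolding abs_mult
    by (rule mult_mono[OF _ D]) (use N eta in \<open>auto simp: occ_def intro!: flip_site_configs\<close>)
  have 3: "\<bar>\<beta> * occ \<eta> N * (f (flip_site N \<eta>) - f \<eta>)\<bar> \<le> \<bar>\<beta>\<bar> * (2 * B)"
    unfolding abs_mult
    by (rule mult_mono[OF _ D]) (use N eta in \<open>auto simp: occ_def intro!: flip_site_configs\<close>)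
  have "\<bar>asep_gen N q \<alpha> \<beta> f \<eta>\<bar>
      \<le> real N * ((1 + \<bar>q\<bar>) * (2 * B)) + \<bar>\<alpha>\<bar> * (2 * B) + \<bar>\<beta>\<bar> * (2 * B)"
    unfolding asep_gen_def using 1 2 3 by linarith
  also have "\<dots> = 2 * (real N * (1 + \<bar>q\<bar>) + \<bar>\<alpha>\<bar> + \<bar>\<beta>\<bar>) * B"
    by (simp add: algebra_simps)
  finally show ?thesis .
qed

lemma summable_asep_semigroup:
  assumes N: "N \<ge> 1" and eta: "\<eta> \<in> configs {1..N}"
  shows "summable (\<lambda>n. t ^ n / fact n * (asep_gen N q \<alpha> \<beta> ^^ n) f \<eta>)"
proof -
  define C where "C = 2 * (real N * (1 + \<bar>q\<bar>) + \<bar>\<alpha>\<bar> + \<bar>\<beta>\<bar>)"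
  define B where "B = Max ((\<lambda>\<eta>. \<bar>f \<eta>\<bar>) ` configs {1..N})"
  have b: "\<bar>(asep_gen N q \<alpha> \<beta> ^^ n) f \<zeta>\<bar> \<le> C ^ n * B" if "\<zeta> \<in> configs {1..N}" for n \<zeta>
    using that
  proof (induction n arbitrary: \<zeta>)
    case 0
    then show ?case by (auto simp: B_def finite_configs intro!: Max_ge)
  next
    case (Suc n)
    have "\<bar>asep_gen N q \<alpha> \<beta> ((asep_gen N q \<alpha> \<beta> ^^ n) f) \<zeta>\<bar> \<le> C * (C ^ n * B)"
      unfolding C_def by (rule asep_gen_bound[OF N]) (use Suc in \<open>auto simp: C_def\<close>)
    then show ?case by (simp add: mult.assoc)
  qed
  have s: "summable (\<lambda>n. B * (inverse (fact n) * (\<bar>t\<bar> * C) ^ n))"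
    by (intro summable_mult summable_exp)
  show ?thesis
  proof (rule summable_comparison_test'[OF s, of 0])
    fix n
    have "norm (t ^ n / fact n * (asep_gen N q \<alpha> \<beta> ^^ n) f \<eta>)
        = \<bar>t\<bar> ^ n / fact n * \<bar>(asep_gen N q \<alpha> \<beta> ^^ n) f \<eta>\<bar>"
      by (simp add: abs_mult power_abs)
    also have "\<dots> \<le> \<bar>t\<bar> ^ n / fact n * (C ^ n * B)"
      by (rule mult_left_mono[OF b[OF eta]]) auto
    also have "\<dots> = B * (inverse (fact n) * (\<bar>t\<bar> * C) ^ n)"
      by (simp add: field_simps power_mult_distrib)
    finally show "norm (t ^ n / fact n * (asep_gen N q \<alpha> \<beta> ^^ n) f \<eta>)
        \<le> B * (inverse (fact n) * (\<bar>t\<bar> * C) ^ n)" .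
  qed
qed

lemma expectation_configs:
  assumes "set_pmf \<mu> \<subseteq> configs {1..N}"
  shows "measure_pmf.expectation \<mu> f = (\<Sum>\<eta>\<in>configs {1..N}. pmf \<mu> \<eta> * f \<eta>)"
  by (subst integral_measure_pmf[of "configs {1..N}"])
     (use assms in \<open>auto simp: finite_configs\<close>)

lemma expectation_asep_semigroup_sums:
  assumes N: "N \<ge> 1" and mu: "set_pmf \<mu> \<subseteq> configs {1..N}"
  shows "(\<lambda>n. measure_pmf.expectation \<mu> ((asep_gen N q \<alpha> \<beta> ^^ n) f) / fact n * t ^ n)
           sums measure_pmf.expectation \<mu> (asep_semigroup N q \<alpha> \<beta> t f)"
proof -
  have "(\<lambda>n. \<Sum>\<eta>\<in>configs {1..N}. pmf \<mu> \<eta> * (t ^ n / fact n * (asep_gen N q \<alpha> \<beta> ^^ n) f \<eta>))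
      sums (\<Sum>\<eta>\<in>configs {1..N}. pmf \<mu> \<eta> * asep_semigroup N q \<alpha> \<beta> t f \<eta>)"
    unfolding asep_semigroup_def
    by (intro sums_sum sums_mult summable_sums summable_asep_semigroup N)
  then show ?thesis
    by (simp add: expectation_configs[OF mu] sum_distrib_left sum_distrib_right
        sum_divide_distrib mult_ac)
qed

lemma asep_stationary_iff_gen:
  assumes N: "N \<ge> 1"
  shows "asep_stationary N q \<alpha> \<beta> \<mu> \<longleftrightarrow>
     set_pmf \<mu> \<subseteq> configs {1..N} \<and>
     (\<forall>f. measure_pmf.expectation \<mu> (asep_gen N q \<alpha> \<beta> f) = 0)" (is "?L \<longleftrightarrow> ?R")
proof
  assume L: ?L
  then have mu: "set_pmf \<mu> \<subseteq> configs {1..N}" by (simp add: asep_stationary_def)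
  have "measure_pmf.expectation \<mu> (asep_gen N q \<alpha> \<beta> f) = 0" for f
  proof -
    define c where "c n = measure_pmf.expectation \<mu> ((asep_gen N q \<alpha> \<beta> ^^ n) f) / fact n" for n
    define S where "S t = (\<Sum>n. c n * t ^ n)" for t
    have sums: "(\<lambda>n. c n * t ^ n) sums measure_pmf.expectation \<mu> (asep_semigroup N q \<alpha> \<beta> t f)" for t
      unfolding c_def by (rule expectation_asep_semigroup_sums[OF N mu])
    have S: "S t = measure_pmf.expectation \<mu> f" if "t \<ge> 0" for t
      using sums[of t] L that by (auto simp: S_def asep_stationary_def sums_iff)
    have "(S has_real_derivative (\<Sum>n. diffs c n * 0 ^ n)) (at 0)"
      unfolding S_def
      by (rule termdiffs_strong_converges_everywhere) (use sums in \<open>auto simp: sums_iff\<close>)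
    then have "(S has_real_derivative c 1) (at 0)"
      by (simp add: diffs_def)
    then have "(S has_real_derivative c 1) (at 0 within {0..})"
      by (rule has_field_derivative_at_within)
    then have "((\<lambda>_. measure_pmf.expectation \<mu> f) has_real_derivative c 1) (at 0 within {0..})"
      by (rule has_field_derivative_transform_within[of _ _ _ _ 1]) (use S in auto)
    then have "((\<lambda>y. 0) \<longlongrightarrow> c 1) (at_right (0::real))"
      by (simp add: has_field_derivative_iff at_within_Ici_at_right)
    then have "c 1 = 0"
      using tendsto_unique[OF trivial_limit_at_right_real _ tendsto_const] by fastforce
    then show ?thesis by (simp add: c_def)
  qed
  with mu show ?R by blast
next
  assume R: ?R
  then have mu: "set_pmf \<mu> \<subseteq> configs {1..N}" by simp
  have "measure_pmf.expectation \<mu> (asep_semigroup N q \<alpha> \<beta> t f) = measure_pmf.expectation \<mu> f" for t f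
  proof -
    have "measure_pmf.expectation \<mu> ((asep_gen N q \<alpha> \<beta> ^^ n) f) / fact n * t ^ n
        = (if n = 0 then measure_pmf.expectation \<mu> f else 0)" for n
      using R by (cases n) auto
    with expectation_asep_semigroup_sums[OF N mu, of q \<alpha> \<beta> f t]
    show ?thesis
      using sums_unique2 sums_single[of 0 "\<lambda>_. measure_pmf.expectation \<mu> f"] by fastforce
  qed
  with mu show ?L by (simp add: asep_stationary_def)
qed

end

theory Submission
  imports Defs
begin

text \<open>
  Consider the low density phase; there \<open>u > 1\<close>, and \<open>v\<close> lies strictly between \<open>- u\<close> and \<open>u\<close>. The
  stationary probability of \<open>\<eta>\<close> is proportional to a matrix product
  \<open>\<langle>W| X\<^sub>1 \<dots> X\<^sub>N |V\<rangle>\<close> with \<open>X\<^sub>x = D\<close> at occupied and \<open>X\<^sub>x = E\<close> at empty sites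
  (\<open>weight_signed_stationary\<close> together with the uniqueness statement \<open>stationary_eq_weights\<close>). For
  \<open>u > 1\<close> there is a basis, indexed by \<open>k = 0, 1, 2, \<dots>\<close>, in which \<open>D\<close> and \<open>E\<close> have nonnegative
  entries, \<open>D + E\<close> is a constant multiple of the transition matrix of a birth and death chain \<open>K\<close>,
  \<open>\<langle>W|\<close> is the point mass at \<open>0\<close> and \<open>|V\<rangle>\<close> is the function \<open>(u v)\<^sup>k\<close>. Moreover each of \<open>D\<close> and \<open>E\<close> has
  constant row sums, of ratio \<open>1 : u\<close>. In probabilistic terms: attach to every step of \<open>K\<close>, started at
  \<open>0\<close>, an occupation variable; then the \<open>N\<close> variables are independent Bernoulli variables with density
  \<open>1 / (1 + u)\<close>, and the stationary measure is their law reweighted by \<open>(u v)\<close> to the power \<open>K\<^sub>N\<close>.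

  The chain \<open>K\<close> has a drift to the left and is positive recurrent. If \<open>n\<close> steps remain after site \<open>b\<close>,
  the density of the marginal on \<open>{1..b}\<close> with respect to the Bernoulli measure is, at the level of
  \<open>K\<close>, the conditional expectation of the reweighting factor given \<open>K\<^sub>b\<close>, divided by its expectation.
  By ergodicity this tends to 1 in \<open>L\<^sup>1\<close> as \<open>n\<close> grows, uniformly in \<open>b\<close>, because the law of \<open>K\<^sub>b\<close> is
  dominated by a fixed multiple of the invariant measure (\<open>tv_dist_prefix_le\<close>, \<open>ergodic\<close>). The limit of
  the normalisation is a ratio of \<open>q\<close>-exponentials and hence positive even when \<open>u v < 0\<close> (\<open>mass_power_pos\<close>).
  Passing from \<open>{1..b}\<close> to a subinterval can only decrease the total variation distance.

  The high density phase is the image of the low density phase under exchange of particles and holes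
  combined with reflection of space.
\<close>

section \<open>Uniqueness of the stationary distribution\<close>

lemma sgn_step_nonpos: "(a::real) * (sgn b - sgn a) \<le> 0"
  by (auto simp: sgn_if mult_le_0_iff)

text \<open>
  The weights obtained later are stationary before anything is known about their sign, so uniqueness
  is needed among signed measures.
\<close>
definition signed_stationary ::
  "nat \<Rightarrow> real \<Rightarrow> real \<Rightarrow> real \<Rightarrow> ((nat \<Rightarrow> bool) \<Rightarrow> real) \<Rightarrow> bool" where
  "signed_stationary N q \<alpha> \<beta> x \<longleftrightarrow>
     (\<forall>f. (\<Sum>\<eta>\<in>configs {1..N}. x \<eta> * asep_gen N q \<alpha> \<beta> f \<eta>) = 0)"

text \<open>
  The test function is the sign \<open>s\<close> of \<open>x\<close> itself. Each summand of \<open>x \<eta> * L s \<eta>\<close> has the form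
  rate times \<open>x \<eta> * (s \<zeta> - s \<eta>)\<close>, which is never positive, while the sum of all of them over \<open>\<eta>\<close>
  vanishes. Hence every summand vanishes, and the sign cannot change along a jump of positive rate that
  starts in the support of \<open>x\<close>. Only right jumps and exits are recorded, because their rates
  stay positive at \<open>q = 0\<close>.
\<close>
lemma signed_stationary_sgn_propagates:
  assumes q: "0 \<le> q" and \<alpha>: "0 \<le> \<alpha>" and \<beta>: "0 < \<beta>"
    and null: "signed_stationary N q \<alpha> \<beta> x"
    and \<eta>: "\<eta> \<in> configs {1..N}" and x: "x \<eta> \<noteq> 0"
  shows "\<lbrakk>y \<in> {1..<N}; \<eta> y; \<not> \<eta> (y + 1)\<rbrakk> \<Longrightarrow> sgn (x (swap_sites y (y + 1) \<eta>)) = sgn (x \<eta>)"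
    and "\<eta> N \<Longrightarrow> sgn (x (flip_site N \<eta>)) = sgn (x \<eta>)"
proof -
  define s where "s \<zeta> = sgn (x \<zeta>)" for \<zeta>
  define r where "r \<zeta> y = occ \<zeta> y * (1 - occ \<zeta> (y + 1)) + q * occ \<zeta> (y + 1) * (1 - occ \<zeta> y)" for \<zeta> y
  have r0: "r \<zeta> y \<ge> 0" for \<zeta> y
    using q by (auto simp: r_def occ_def)
  define A where "A \<zeta> = (\<Sum>y\<in>{1..<N}. r \<zeta> y * (x \<zeta> * (s (swap_sites y (y + 1) \<zeta>) - s \<zeta>)))" for \<zeta>
  define B where "B \<zeta> = \<alpha> * (1 - occ \<zeta> 1) * (x \<zeta> * (s (flip_site 1 \<zeta>) - s \<zeta>))" for \<zeta>
  define C where "C \<zeta> = \<beta> * occ \<zeta> N * (x \<zeta> * (s (flip_site N \<zeta>) - s \<zeta>))" for \<zeta>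
  have neg: "x \<zeta> * (s \<xi> - s \<zeta>) \<le> 0" for \<zeta> \<xi>
    unfolding s_def by (rule sgn_step_nonpos)
  have A0: "A \<zeta> \<le> 0" for \<zeta>
    unfolding A_def by (intro sum_nonpos mult_nonneg_nonpos r0 neg)
  have B0: "B \<zeta> \<le> 0" for \<zeta>
    unfolding B_def by (intro mult_nonneg_nonpos neg) (use \<alpha> in \<open>auto simp: occ_def\<close>)
  have C0: "C \<zeta> \<le> 0" for \<zeta>
    unfolding C_def by (intro mult_nonneg_nonpos neg) (use \<beta> in \<open>auto simp: occ_def\<close>)
  have gen: "x \<zeta> * asep_gen N q \<alpha> \<beta> s \<zeta> = A \<zeta> + B \<zeta> + C \<zeta>" for \<zeta>
    by (simp add: asep_gen_def A_def B_def C_def r_def algebra_simps sum_distrib_left)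
  have "(\<Sum>\<zeta>\<in>configs {1..N}. - (A \<zeta> + B \<zeta> + C \<zeta>)) = 0"
    using null unfolding signed_stationary_def gen[symmetric] by (simp add: sum_negf)
  then have "\<forall>\<zeta>\<in>configs {1..N}. - (A \<zeta> + B \<zeta> + C \<zeta>) = 0"
  proof (subst (asm) sum_nonneg_eq_0_iff)
    show "0 \<le> - (A \<zeta> + B \<zeta> + C \<zeta>)" for \<zeta>
      using A0[of \<zeta>] B0[of \<zeta>] C0[of \<zeta>] by linarith
  qed (simp_all add: finite_configs)
  with \<eta> have "A \<eta> + B \<eta> + C \<eta> = 0" by auto
  with A0[of \<eta>] B0[of \<eta>] C0[of \<eta>] have A: "A \<eta> = 0" and C: "C \<eta> = 0" by linarith+
  have "(\<Sum>y\<in>{1..<N}. - (r \<eta> y * (x \<eta> * (s (swap_sites y (y + 1) \<eta>) - s \<eta>)))) = 0"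
    using A by (simp add: A_def sum_negf)
  then have *: "\<forall>y\<in>{1..<N}. - (r \<eta> y * (x \<eta> * (s (swap_sites y (y + 1) \<eta>) - s \<eta>))) = 0"
    by (subst (asm) sum_nonneg_eq_0_iff) (auto intro!: mult_nonneg_nonpos r0 neg)
  show "sgn (x (swap_sites y (y + 1) \<eta>)) = sgn (x \<eta>)" if "y \<in> {1..<N}" "\<eta> y" "\<not> \<eta> (y + 1)"
  proof -
    have "r \<eta> y = 1" using that by (simp add: r_def occ_def)
    with bspec[OF * that(1)] x show ?thesis by (simp add: s_def)
  qed
  show "sgn (x (flip_site N \<eta>)) = sgn (x \<eta>)" if "\<eta> N"
    using C that x \<beta> by (simp add: C_def occ_def s_def)
qed

text \<open>
  Moving the rightmost particle to the right, and finally out of the system, leads from every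
  configuration to the empty one. The sign is carried along, so the path never leaves the support
  of \<open>x\<close>.
\<close>
lemma signed_stationary_sgn_constant:
  assumes q: "0 \<le> q" and \<alpha>: "0 \<le> \<alpha>" and \<beta>: "0 < \<beta>"
    and null: "signed_stationary N q \<alpha> \<beta> x"
    and \<eta>: "\<eta> \<in> configs {1..N}" and x: "x \<eta> \<noteq> 0"
  shows "sgn (x \<eta>) = sgn (x (\<lambda>_. False))"
  using \<eta> x
\<comment> \<open>The measure counts the steps that the particles need to leave the system on the right.\<close>
proof (induction "\<Sum>y | \<eta> y. N + 1 - y" arbitrary: \<eta> rule: less_induct)
  case less
  have sub: "{y. \<eta> y} \<subseteq> {1..N}"
    using less.prems(1) by (auto simp: configs_def PiE_dflt_def)
  then have fin: "finite {y. \<eta> y}" by (rule finite_subset) simp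
  note propagate = signed_stationary_sgn_propagates[OF q \<alpha> \<beta> null less.prems]
  show ?case
  proof (cases "{y. \<eta> y} = {}")
    case True
    then have "\<eta> = (\<lambda>_. False)" by auto
    then show ?thesis by simp
  next
    case False
    define y where "y = Max {y. \<eta> y}"
    have y: "\<eta> y" using Max_in[OF fin False] by (simp add: y_def)
    with sub have y1: "y \<in> {1..N}" by auto
    have yS: "\<not> \<eta> (Suc y)"
      using Max_ge[OF fin, of "Suc y"] by (auto simp: y_def)
    have split: "(\<Sum>y | \<eta> y. N + 1 - y) = (N + 1 - y) + (\<Sum>z\<in>{y. \<eta> y} - {y}. N + 1 - z)"
      by (rule sum.remove) (use fin y in auto)
    define \<zeta> where "\<zeta> = (if y = N then flip_site N \<eta> else swap_sites y (y + 1) \<eta>)"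
    have sgn: "sgn (x \<zeta>) = sgn (x \<eta>)"
      using propagate y y1 yS by (auto simp: \<zeta>_def)
    have \<zeta>c: "\<zeta> \<in> configs {1..N}"
      using less.prems(1) y1 by (auto simp: \<zeta>_def intro!: flip_site_configs swap_sites_configs)
    have "(\<Sum>z | \<zeta> z. N + 1 - z) < (\<Sum>z | \<eta> z. N + 1 - z)"
    proof (cases "y = N")
      case True
      then have "{z. \<zeta> z} = {z. \<eta> z} - {y}"
        using y by (auto simp: \<zeta>_def flip_site_def)
      with split True show ?thesis by simp
    next
      case False
      then have "{z. \<zeta> z} = insert (y + 1) ({z. \<eta> z} - {y})"
        using y yS by (auto simp: \<zeta>_def swap_sites_def)
      with split False show ?thesis using fin yS y1 by (simp add: Suc_diff_le)
    qed
    from less.hyps[OF this \<zeta>c] sgn less.prems(2) show ?thesis by (metis sgn_0_0)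
  qed
qed

text \<open>
  A signed stationary measure has constant sign on its support, so total mass 0 forces it to vanish:
  the stationary vectors form a space of dimension at most one.
\<close>
lemma signed_stationary_zero:
  assumes q: "0 \<le> q" and \<alpha>: "0 \<le> \<alpha>" and \<beta>: "0 < \<beta>"
    and null: "signed_stationary N q \<alpha> \<beta> x"
    and total: "(\<Sum>\<eta>\<in>configs {1..N}. x \<eta>) = 0"
    and \<eta>: "\<eta> \<in> configs {1..N}"
  shows "x \<eta> = 0"
proof -
  define \<sigma> where "\<sigma> = sgn (x (\<lambda>_. False))"
  have abs: "\<bar>x \<zeta>\<bar> = \<sigma> * x \<zeta>" if "\<zeta> \<in> configs {1..N}" for \<zeta>
    using signed_stationary_sgn_constant[OF q \<alpha> \<beta> null that]
    by (cases "x \<zeta> = 0") (simp_all add: \<sigma>_def abs_sgn mult.commute)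
  have "(\<Sum>\<zeta>\<in>configs {1..N}. \<bar>x \<zeta>\<bar>) = \<sigma> * (\<Sum>\<zeta>\<in>configs {1..N}. x \<zeta>)"
    by (simp add: abs sum_distrib_left)
  also have "\<dots> = 0" unfolding total by simp
  finally show ?thesis
    using \<eta> by (subst (asm) sum_nonneg_eq_0_iff) (auto simp: finite_configs)
qed

lemma stationary_eq_weights:
  assumes N: "N \<ge> 1" and q: "0 \<le> q" and \<alpha>: "0 \<le> \<alpha>" and \<beta>: "0 < \<beta>"
    and stat: "asep_stationary N q \<alpha> \<beta> \<mu>"
    and null: "signed_stationary N q \<alpha> \<beta> w"
    and Z: "Z = (\<Sum>\<eta>\<in>configs {1..N}. w \<eta>)" "Z \<noteq> 0"
    and \<eta>: "\<eta> \<in> configs {1..N}"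
  shows "pmf \<mu> \<eta> = w \<eta> / Z"
proof -
  from stat have set: "set_pmf \<mu> \<subseteq> configs {1..N}"
    and E: "measure_pmf.expectation \<mu> (asep_gen N q \<alpha> \<beta> f) = 0" for f
    by (auto simp: asep_stationary_iff_gen[OF N])
  let ?x = "\<lambda>\<eta>. pmf \<mu> \<eta> - w \<eta> / Z"
  have "signed_stationary N q \<alpha> \<beta> ?x"
    unfolding signed_stationary_def
  proof
    fix f
    have "(\<Sum>\<eta>\<in>configs {1..N}. ?x \<eta> * asep_gen N q \<alpha> \<beta> f \<eta>)
        = (\<Sum>\<eta>\<in>configs {1..N}. pmf \<mu> \<eta> * asep_gen N q \<alpha> \<beta> f \<eta>)
          - (\<Sum>\<eta>\<in>configs {1..N}. w \<eta> * asep_gen N q \<alpha> \<beta> f \<eta>) / Z"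
      by (simp add: algebra_simps sum_subtractf sum_divide_distrib)
    also have "\<dots> = 0"
      using E[of f] null by (simp add: expectation_configs[OF set] signed_stationary_def)
    finally show "(\<Sum>\<eta>\<in>configs {1..N}. ?x \<eta> * asep_gen N q \<alpha> \<beta> f \<eta>) = 0" .
  qed
  moreover have "(\<Sum>\<eta>\<in>configs {1..N}. ?x \<eta>) = 0"
    using Z sum_pmf_eq_1[OF finite_configs set]
    by (simp add: sum_subtractf flip: sum_divide_distrib)
  ultimately have "?x \<eta> = 0"
    using signed_stationary_zero[OF q \<alpha> \<beta> _ _ \<eta>] by blast
  then show ?thesis by simp
qed

section \<open>Matrix product weights\<close>

text \<open>
  In the notation of the matrix product ansatz, \<open>site_op q u True\<close> is \<open>D\<close> and
  \<open>site_op q u False\<close> is \<open>E\<close>, both scaled by \<open>1 - q\<close> and written as operators on functions of a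
  hidden integer. They are \<open>1 + d\<close> and \<open>1 + e\<close> for a pair of \<open>q\<close>-oscillators with
  \<open>d e - q e d = 1 - q\<close>, in a basis conjugated by powers of \<open>u\<close> so that for \<open>u > 0\<close> and
  \<open>0 \<le> q \<le> 1\<close> all coefficients are nonnegative and \<open>D + E\<close> has constant row sums.
  For \<open>k = 0\<close> the truncated \<open>k - 1\<close> is harmless, since its coefficient \<open>1 - q\<^sup>0\<close> is 0.
\<close>
definition site_op :: "real \<Rightarrow> real \<Rightarrow> bool \<Rightarrow> (nat \<Rightarrow> real) \<Rightarrow> nat \<Rightarrow> real" where
  "site_op q u x f k =
     (if x then f k + f (Suc k) / u else (1 + u * q ^ k) * f k + u * (1 - q ^ k) * f (k - 1))"

fun word_op :: "real \<Rightarrow> real \<Rightarrow> bool list \<Rightarrow> (nat \<Rightarrow> real) \<Rightarrow> nat \<Rightarrow> real" where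
  "word_op q u [] f = f"
| "word_op q u (x # xs) f = site_op q u x (word_op q u xs f)"

lemma word_op_append: "word_op q u (xs @ ys) f = word_op q u xs (word_op q u ys f)"
  by (induction xs) auto

lemma site_op_linear:
  "site_op q u x (\<lambda>k. a * f k + b * g k) = (\<lambda>k. a * site_op q u x f k + b * site_op q u x g k)"
  by (rule ext) (simp add: site_op_def algebra_simps add_divide_distrib)

lemma word_op_linear:
  "word_op q u xs (\<lambda>k. a * f k + b * g k) = (\<lambda>k. a * word_op q u xs f k + b * word_op q u xs g k)"
  by (induction xs) (auto simp: site_op_linear)

lemma word_op_scale: "word_op q u xs (\<lambda>k. a * f k) k = a * word_op q u xs f k"
  using word_op_linear[of q u xs a f 0 f] by (simp add: fun_eq_iff)

text \<open>
  The quadratic relation \<open>D E - q E D = (1 - q) (D + E)\<close>, in which the right-hand side has one site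
  less. It makes the bulk terms of the master equation telescope.
\<close>
lemma site_op_commutation:
  assumes "u \<noteq> 0"
  shows "site_op q u True (site_op q u False f) k - q * site_op q u False (site_op q u True f) k
       = (1 - q) * (site_op q u True f k + site_op q u False f k)"
proof (cases k)
  case 0
  then show ?thesis using assms by (simp add: site_op_def field_simps)
next
  case (Suc n)
  then show ?thesis using assms by (simp add: site_op_def field_simps)
qed

text \<open>
  Evaluation at \<open>0\<close> is the left boundary vector, an eigenvector of \<open>E\<close>, and the geometric function
  below is the right boundary vector, an eigenvector of \<open>D\<close>.
\<close>
lemma site_op_False_0: "site_op q u False f 0 = (1 + u) * f 0"
  by (simp add: site_op_def)

lemma site_op_True_power:
  "u \<noteq> 0 \<Longrightarrow> site_op q u True (\<lambda>k. (u * v) ^ k) = (\<lambda>k. (1 + v) * (u * v) ^ k)"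
  by (rule ext) (simp add: site_op_def field_simps)

definition word :: "nat \<Rightarrow> nat \<Rightarrow> (nat \<Rightarrow> bool) \<Rightarrow> bool list" where
  "word m n \<eta> = map \<eta> [m..<n]"

lemma word_split: "m \<le> x \<Longrightarrow> x < n \<Longrightarrow> word m n \<eta> = word m x \<eta> @ \<eta> x # word (Suc x) n \<eta>"
  using upt_add_eq_append[of m x "n - x"] by (simp add: word_def upt_conv_Cons)

lemma word_cong: "(\<And>x. m \<le> x \<Longrightarrow> x < n \<Longrightarrow> \<eta> x = \<zeta> x) \<Longrightarrow> word m n \<eta> = word m n \<zeta>"
  by (auto simp: word_def)

definition weight :: "nat \<Rightarrow> real \<Rightarrow> real \<Rightarrow> (nat \<Rightarrow> real) \<Rightarrow> (nat \<Rightarrow> bool) \<Rightarrow> real" where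
  "weight N q u f \<eta> = word_op q u (word 1 (Suc N) \<eta>) f 0"

text \<open>
  The terms of the telescoping sum in the master equation: the quadratic relation turns the flow
  through a bond into weights of configurations with one of its two sites removed, counted
  positively for a removed particle and negatively for a removed hole.
\<close>
definition deleted_weight ::
  "nat \<Rightarrow> real \<Rightarrow> real \<Rightarrow> (nat \<Rightarrow> real) \<Rightarrow> nat \<Rightarrow> (nat \<Rightarrow> bool) \<Rightarrow> real" where
  "deleted_weight N q u f x \<eta> = (if \<eta> x then 1 else - 1) * (1 - q) *
     word_op q u (word 1 x \<eta> @ word (Suc x) (Suc N) \<eta>) f 0"

definition bond_rate :: "real \<Rightarrow> nat \<Rightarrow> (nat \<Rightarrow> bool) \<Rightarrow> real" where
  "bond_rate q x \<eta> = occ \<eta> x * (1 - occ \<eta> (x + 1)) + q * occ \<eta> (x + 1) * (1 - occ \<eta> x)"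

text \<open>
  The net probability flow into \<open>\<eta>\<close> through one bond is a difference of two deleted weights: for
  unequal occupations this is the quadratic relation, for equal ones both sides vanish.
\<close>
lemma bond_balance:
  assumes u: "u \<noteq> 0" and x: "1 \<le> x" "x < N"
  shows "weight N q u f (swap_sites x (x + 1) \<eta>) * bond_rate q x (swap_sites x (x + 1) \<eta>)
           - weight N q u f \<eta> * bond_rate q x \<eta>
         = deleted_weight N q u f (x + 1) \<eta> - deleted_weight N q u f x \<eta>"
proof -
  define L where "L = word 1 x \<eta>"
  define g where "g = word_op q u (word (x + 2) (Suc N) \<eta>) f"
  define V where "V h = word_op q u L h 0" for h
  let ?D = "site_op q u True" and ?E = "site_op q u False"
  have w: "weight N q u f \<zeta> = V (site_op q u (\<zeta> x) (site_op q u (\<zeta> (Suc x)) g))"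
    if "\<And>y. y \<noteq> x \<Longrightarrow> y \<noteq> Suc x \<Longrightarrow> \<zeta> y = \<eta> y" for \<zeta>
  proof -
    have "word 1 (Suc N) \<zeta> = word 1 x \<zeta> @ \<zeta> x # \<zeta> (Suc x) # word (x + 2) (Suc N) \<zeta>"
      using x by (subst word_split[of _ x]; (subst word_split[of _ "Suc x"])?) (auto simp: word_def)
    moreover have "word 1 x \<zeta> = L" "word (x + 2) (Suc N) \<zeta> = word (x + 2) (Suc N) \<eta>"
      unfolding L_def using that by (auto intro!: word_cong)
    ultimately show ?thesis by (simp add: weight_def word_op_append V_def g_def)
  qed
  have sw: "weight N q u f (swap_sites x (x + 1) \<eta>)
      = V (site_op q u (\<eta> (Suc x)) (site_op q u (\<eta> x) g))"
    by (subst w) (auto simp: swap_sites_def)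
  have d1: "deleted_weight N q u f x \<eta> = (if \<eta> x then 1 else - 1) * (1 - q) * V (site_op q u (\<eta> (Suc x)) g)"
  proof -
    have "word (Suc x) (Suc N) \<eta> = \<eta> (Suc x) # word (x + 2) (Suc N) \<eta>"
      using x by (subst word_split[of _ "Suc x"]) (auto simp: word_def)
    then show ?thesis by (simp add: deleted_weight_def word_op_append V_def g_def L_def)
  qed
  have d2: "deleted_weight N q u f (x + 1) \<eta>
      = (if \<eta> (Suc x) then 1 else - 1) * (1 - q) * V (site_op q u (\<eta> x) g)"
  proof -
    have "word 1 (Suc x) \<eta> = L @ [\<eta> x]"
      using x by (simp add: word_def L_def)
    then show ?thesis by (simp add: deleted_weight_def word_op_append V_def g_def)
  qed
  have "(\<lambda>k. 1 * ?D (?E g) k + (- q) * ?E (?D g) k) = (\<lambda>k. (1 - q) * ?D g k + (1 - q) * ?E g k)"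
    using site_op_commutation[OF u, of q g] by (auto simp: algebra_simps)
  from arg_cong[OF this, of V]
  have comm: "V (?D (?E g)) - q * V (?E (?D g)) = (1 - q) * V (?D g) + (1 - q) * V (?E g)"
    unfolding V_def word_op_linear by simp
  show ?thesis
    using comm unfolding w[OF refl] sw d1 d2
    by (cases "\<eta> x"; cases "\<eta> (Suc x)")
       (auto simp: bond_rate_def occ_def swap_sites_def algebra_simps)
qed

lemma swap_sites_swap_sites [simp]: "swap_sites x y (swap_sites x y \<eta>) = \<eta>"
  by (auto simp: swap_sites_def)

lemma flip_site_flip_site [simp]: "flip_site x (flip_site x \<eta>) = \<eta>"
  by (auto simp: flip_site_def)

lemma sum_configs_swap:
  assumes "x \<in> A" "y \<in> A"
  shows "(\<Sum>\<eta>\<in>configs A. F (swap_sites x y \<eta>)) = (\<Sum>\<eta>\<in>configs A. F \<eta>)"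
  by (rule sum.reindex_bij_witness[of _ "swap_sites x y" "swap_sites x y"])
     (use assms in \<open>auto simp: swap_sites_configs\<close>)

lemma sum_configs_flip:
  assumes "x \<in> A"
  shows "(\<Sum>\<eta>\<in>configs A. F (flip_site x \<eta>)) = (\<Sum>\<eta>\<in>configs A. F \<eta>)"
  by (rule sum.reindex_bij_witness[of _ "flip_site x" "flip_site x"])
     (use assms in \<open>auto simp: flip_site_configs\<close>)

text \<open>
  Summing the bond flows leaves \<open>a N - a 1\<close>, and the two boundary relations identify the flows
  through the reservoirs with \<open>a 1\<close> and \<open>- a N\<close>. The argument is purely algebraic and independent
  of the signs of the weights, which for \<open>v < 0\<close> are not visible from their definition.
\<close>
lemma weight_signed_stationary:
  assumes N: "N \<ge> 1" and u0: "u \<noteq> 0"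
    and u: "\<alpha> * (1 + u) = 1 - q" and v: "\<beta> * (1 + v) = 1 - q"
  shows "signed_stationary N q \<alpha> \<beta> (weight N q u (\<lambda>k. (u * v) ^ k))"
  unfolding signed_stationary_def
proof
  fix g :: "(nat \<Rightarrow> bool) \<Rightarrow> real"
  define w where "w = weight N q u (\<lambda>k. (u * v) ^ k)"
  define a where "a = deleted_weight N q u (\<lambda>k. (u * v) ^ k)"
  let ?C = "configs {1..N}"
  \<comment> \<open>Substituting the swapped configuration moves the generator from the test function to the weight.\<close>
  have bond: "(\<Sum>\<eta>\<in>?C. w \<eta> * (bond_rate q x \<eta> * (g (swap_sites x (x + 1) \<eta>) - g \<eta>)))
      = (\<Sum>\<eta>\<in>?C. g \<eta> * (a (x + 1) \<eta> - a x \<eta>))" if x: "x \<in> {1..<N}" for x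
  proof -
    let ?s = "swap_sites x (x + 1)"
    have "(\<Sum>\<eta>\<in>?C. w \<eta> * bond_rate q x \<eta> * g (?s \<eta>)) = (\<Sum>\<eta>\<in>?C. w (?s \<eta>) * bond_rate q x (?s \<eta>) * g \<eta>)"
      using sum_configs_swap[of x "{1..N}" "x + 1" "\<lambda>\<eta>. w \<eta> * bond_rate q x \<eta> * g (?s \<eta>)"] x by simp
    then have "(\<Sum>\<eta>\<in>?C. w \<eta> * (bond_rate q x \<eta> * (g (?s \<eta>) - g \<eta>)))
        = (\<Sum>\<eta>\<in>?C. g \<eta> * (w (?s \<eta>) * bond_rate q x (?s \<eta>) - w \<eta> * bond_rate q x \<eta>))"
      by (simp add: algebra_simps sum_subtractf)
    also have "\<dots> = (\<Sum>\<eta>\<in>?C. g \<eta> * (a (x + 1) \<eta> - a x \<eta>))"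
      unfolding w_def a_def using x by (intro sum.cong refl) (subst bond_balance[OF u0], auto)
    finally show ?thesis .
  qed
  have left: "(\<Sum>\<eta>\<in>?C. w \<eta> * (\<alpha> * (1 - occ \<eta> 1) * (g (flip_site 1 \<eta>) - g \<eta>)))
      = (\<Sum>\<eta>\<in>?C. g \<eta> * a 1 \<eta>)"
  proof -
    let ?s = "flip_site 1"
    have eq: "w (?s \<eta>) * (\<alpha> * (1 - occ (?s \<eta>) 1)) - w \<eta> * (\<alpha> * (1 - occ \<eta> 1)) = a 1 \<eta>" for \<eta>
    proof -
      define h where "h = word_op q u (word 2 (Suc N) \<eta>) (\<lambda>k. (u * v) ^ k)"
      have W: "w \<zeta> = site_op q u (\<zeta> 1) h 0" if "\<And>y. y \<noteq> 1 \<Longrightarrow> \<zeta> y = \<eta> y" for \<zeta>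
      proof -
        have "word 1 (Suc N) \<zeta> = \<zeta> 1 # word 2 (Suc N) \<zeta>"
          using N by (subst word_split[of _ 1]) (auto simp: word_def numeral_2_eq_2)
        moreover have "word 2 (Suc N) \<zeta> = word 2 (Suc N) \<eta>"
          using that by (auto intro!: word_cong)
        ultimately show ?thesis by (simp add: w_def weight_def h_def)
      qed
      have A: "a 1 \<eta> = (if \<eta> 1 then 1 else - 1) * (1 - q) * h 0"
        by (simp add: a_def deleted_weight_def h_def word_def numeral_2_eq_2)
      have "\<alpha> * (site_op q u False h 0) = (1 - q) * h 0"
        unfolding site_op_False_0 by (simp flip: u mult.assoc)
      then show ?thesis
        unfolding A by (subst (1 2) W) (auto simp: flip_site_def occ_def algebra_simps)
    qed
    have "(\<Sum>\<eta>\<in>?C. w \<eta> * (\<alpha> * (1 - occ \<eta> 1)) * g (?s \<eta>))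
        = (\<Sum>\<eta>\<in>?C. w (?s \<eta>) * (\<alpha> * (1 - occ (?s \<eta>) 1)) * g \<eta>)"
      using sum_configs_flip[of 1 "{1..N}" "\<lambda>\<eta>. w \<eta> * (\<alpha> * (1 - occ \<eta> 1)) * g (?s \<eta>)"] N by simp
    then have "(\<Sum>\<eta>\<in>?C. w \<eta> * (\<alpha> * (1 - occ \<eta> 1) * (g (?s \<eta>) - g \<eta>)))
        = (\<Sum>\<eta>\<in>?C. g \<eta> * (w (?s \<eta>) * (\<alpha> * (1 - occ (?s \<eta>) 1)) - w \<eta> * (\<alpha> * (1 - occ \<eta> 1))))"
      by (simp add: algebra_simps sum_subtractf sum.distrib)
    then show ?thesis by (simp only: eq)
  qed
  have right: "(\<Sum>\<eta>\<in>?C. w \<eta> * (\<beta> * occ \<eta> N * (g (flip_site N \<eta>) - g \<eta>)))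
      = (\<Sum>\<eta>\<in>?C. g \<eta> * - a N \<eta>)"
  proof -
    let ?s = "flip_site N"
    have eq: "w (?s \<eta>) * (\<beta> * occ (?s \<eta>) N) - w \<eta> * (\<beta> * occ \<eta> N) = - a N \<eta>" for \<eta>
    proof -
      define L where "L = word 1 N \<eta>"
      define f where "f = (\<lambda>k. (u * v) ^ k)"
      have W: "w \<zeta> = word_op q u L (site_op q u (\<zeta> N) f) 0" if "\<And>y. y \<noteq> N \<Longrightarrow> \<zeta> y = \<eta> y" for \<zeta>
      proof -
        have "word 1 (Suc N) \<zeta> = word 1 N \<zeta> @ [\<zeta> N]"
          using N by (subst word_split[of _ N]) (auto simp: word_def)
        moreover have "word 1 N \<zeta> = L"
          unfolding L_def using that by (auto intro!: word_cong)
        ultimately show ?thesis by (simp add: w_def weight_def word_op_append f_def)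
      qed
      have A: "a N \<eta> = (if \<eta> N then 1 else - 1) * (1 - q) * word_op q u L f 0"
        by (simp add: a_def deleted_weight_def L_def word_def f_def)
      have "\<beta> * word_op q u L (site_op q u True f) 0 = (1 - q) * word_op q u L f 0"
        unfolding f_def site_op_True_power[OF u0] word_op_scale by (simp flip: v mult.assoc)
      then show ?thesis
        unfolding A by (subst (1 2) W) (auto simp: flip_site_def occ_def algebra_simps)
    qed
    have "(\<Sum>\<eta>\<in>?C. w \<eta> * (\<beta> * occ \<eta> N) * g (?s \<eta>)) = (\<Sum>\<eta>\<in>?C. w (?s \<eta>) * (\<beta> * occ (?s \<eta>) N) * g \<eta>)"
      using sum_configs_flip[of N "{1..N}" "\<lambda>\<eta>. w \<eta> * (\<beta> * occ \<eta> N) * g (?s \<eta>)"] N by simp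
    then have "(\<Sum>\<eta>\<in>?C. w \<eta> * (\<beta> * occ \<eta> N * (g (?s \<eta>) - g \<eta>)))
        = (\<Sum>\<eta>\<in>?C. g \<eta> * (w (?s \<eta>) * (\<beta> * occ (?s \<eta>) N) - w \<eta> * (\<beta> * occ \<eta> N)))"
      by (simp add: algebra_simps sum_subtractf)
    then show ?thesis by (simp only: eq)
  qed
  have "(\<Sum>\<eta>\<in>?C. w \<eta> * asep_gen N q \<alpha> \<beta> g \<eta>)
      = (\<Sum>x\<in>{1..<N}. \<Sum>\<eta>\<in>?C. w \<eta> * (bond_rate q x \<eta> * (g (swap_sites x (x + 1) \<eta>) - g \<eta>)))
        + (\<Sum>\<eta>\<in>?C. w \<eta> * (\<alpha> * (1 - occ \<eta> 1) * (g (flip_site 1 \<eta>) - g \<eta>)))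
        + (\<Sum>\<eta>\<in>?C. w \<eta> * (\<beta> * occ \<eta> N * (g (flip_site N \<eta>) - g \<eta>)))"
    by (subst sum.swap)
       (simp add: asep_gen_def bond_rate_def distrib_left sum.distrib sum_distrib_left)
  also have "\<dots> = (\<Sum>x\<in>{1..<N}. \<Sum>\<eta>\<in>?C. g \<eta> * (a (x + 1) \<eta> - a x \<eta>))
        + (\<Sum>\<eta>\<in>?C. g \<eta> * a 1 \<eta>) + (\<Sum>\<eta>\<in>?C. g \<eta> * - a N \<eta>)"
    using bond left right by simp
  also have "\<dots> = (\<Sum>\<eta>\<in>?C. g \<eta> * ((\<Sum>x\<in>{1..<N}. a (x + 1) \<eta> - a x \<eta>) + a 1 \<eta> - a N \<eta>))"
    by (subst sum.swap)
       (simp add: algebra_simps sum.distrib sum_subtractf sum_distrib_left sum_negf)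
  also have "\<dots> = 0"
  proof -
    have "(\<Sum>x\<in>{1..<N}. a (x + 1) \<eta> - a x \<eta>) = a N \<eta> - a 1 \<eta>" for \<eta>
      using sum_Suc_diff'[of 1 N "\<lambda>x. a x \<eta>"] N by simp
    then show ?thesis by simp
  qed
  finally show "(\<Sum>\<eta>\<in>?C. weight N q u (\<lambda>k. (u * v) ^ k) \<eta> * asep_gen N q \<alpha> \<beta> g \<eta>) = 0"
    by (simp add: w_def)
qed

section \<open>The hidden birth and death chain\<close>

text \<open>
  The condition \<open>1 < u\<close> is the low density condition on the left reservoir. It gives the chain
  below a drift towards 0.
\<close>
locale hidden_chain =
  fixes q u :: real
  assumes q0: "0 \<le> q" and q1: "q < 1" and u1: "1 < u"
begin

text \<open>
  The constant row sum of \<open>D + E\<close>. It is also the top eigenvalue of the matrix product, with the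
  constant functions as right eigenvectors.
\<close>
definition lam :: real where "lam = (1 + u)\<^sup>2 / u"

text \<open>
  The transition operator of a birth and death chain: up with probability \<open>1 / (u lam)\<close>, down from
  \<open>k\<close> with probability \<open>u (1 - q\<^sup>k) / lam\<close>, and otherwise staying put.
\<close>
definition step :: "(nat \<Rightarrow> real) \<Rightarrow> nat \<Rightarrow> real" where
  "step f k = (site_op q u True f k + site_op q u False f k) / lam"

text \<open>
  The reversible measure of the chain, normalised by its value 1 at the starting point 0 instead of by
  its total mass. In closed form it is \<open>u\<close> to the power \<open>- 2 k\<close>, divided by the \<open>q\<close>-Pochhammer symbol
  \<open>(q; q)\<^sub>k\<close>.
\<close>
definition \<pi> :: "nat \<Rightarrow> real" where
  invariant_def: "\<pi> k = (\<Prod>i<k. 1 / (u\<^sup>2 * (1 - q ^ Suc i)))"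

definition mass :: "(nat \<Rightarrow> real) \<Rightarrow> real" where
  "mass f = (\<Sum>k. \<pi> k * f k)"

definition L1 :: "(nat \<Rightarrow> real) \<Rightarrow> bool" where
  "L1 f \<longleftrightarrow> summable (\<lambda>k. \<pi> k * \<bar>f k\<bar>)"

lemma u0: "u > 0" "u \<noteq> 0" using u1 by auto

lemma lam_pos: "lam > 0" using u1 by (simp add: lam_def)

lemma lam_eq: "lam = 2 + u + 1 / u"
  using u1 by (simp add: lam_def field_simps power2_eq_square)

lemma q_power_bounds: "0 \<le> q ^ k" "q ^ k \<le> 1"
  using q0 q1 by (auto simp: power_le_one)

lemma q_power_Suc_less: "q ^ Suc k < 1"
  using mult_left_le[of "q ^ k" q] q_power_bounds[of k] q0 q1 by simp

lemma invariant_0 [simp]: "\<pi> 0 = 1" by (simp add: invariant_def)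

lemma invariant_pos: "\<pi> k > 0"
  unfolding invariant_def using q_power_Suc_less u0 by (intro prod_pos) auto

lemma invariant_nonneg [simp]: "0 \<le> \<pi> k"
  using invariant_pos[of k] by simp

lemma invariant_Suc: "\<pi> (Suc k) = \<pi> k / (u\<^sup>2 * (1 - q ^ Suc k))"
  by (simp add: invariant_def)

lemma detailed_balance: "\<pi> (Suc k) * (u * (1 - q ^ Suc k)) = \<pi> k / u"
  using q_power_Suc_less[of k] u0 by (simp add: invariant_Suc power2_eq_square)

lemma summable_invariant_power:
  assumes s: "0 \<le> s" "s < u\<^sup>2"
  shows "summable (\<lambda>k. \<pi> k * s ^ k)"
proof -
  have "s / u\<^sup>2 < 1" using s u0 by simp
  then obtain c where c: "s / u\<^sup>2 < c" "c < 1" using dense by blast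
  have "(\<lambda>k. q ^ Suc k) \<longlonglongrightarrow> 0"
    using LIMSEQ_realpow_zero[OF q0 q1] by (rule LIMSEQ_Suc)
  then have "(\<lambda>k. s / (u\<^sup>2 * (1 - q ^ Suc k))) \<longlonglongrightarrow> s / (u\<^sup>2 * (1 - 0))"
    by (intro tendsto_intros) (use u0 in auto)
  then have "\<forall>\<^sub>F k in sequentially. s / (u\<^sup>2 * (1 - q ^ Suc k)) < c"
    by (rule order_tendstoD(2)) (use c in simp)
  then obtain K where K: "s / (u\<^sup>2 * (1 - q ^ Suc k)) < c" if "k \<ge> K" for k
    by (auto simp: eventually_sequentially)
  show ?thesis
  proof (rule summable_ratio_test[OF c(2)])
    fix k assume "K \<le> k"
    then have "(\<pi> k * s ^ k) * (s / (u\<^sup>2 * (1 - q ^ Suc k))) \<le> (\<pi> k * s ^ k) * c"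
      by (intro mult_left_mono less_imp_le[OF K]) (use s in auto)
    moreover have "norm (\<pi> (Suc k) * s ^ Suc k) = (\<pi> k * s ^ k) * (s / (u\<^sup>2 * (1 - q ^ Suc k)))"
    proof -
      have "0 \<le> \<pi> (Suc k) * s ^ Suc k"
        using s by (intro mult_nonneg_nonneg zero_le_power invariant_nonneg)
      then show ?thesis unfolding real_norm_def by (simp only: abs_of_nonneg invariant_Suc) simp
    qed
    moreover have "norm (\<pi> k * s ^ k) = \<pi> k * s ^ k"
      using s by simp
    ultimately show "norm (\<pi> (Suc k) * s ^ Suc k) \<le> c * norm (\<pi> k * s ^ k)"
      by (simp only: mult.commute[of c])
  qed
qed

lemma L1_power: "\<bar>t\<bar> < u\<^sup>2 \<Longrightarrow> L1 (\<lambda>k. t ^ k)"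
  using summable_invariant_power[of "\<bar>t\<bar>"] by (simp add: L1_def power_abs)

lemma L1_const: "L1 (\<lambda>_. a)"
proof -
  have "1 < u\<^sup>2" using u1 by (simp add: power2_eq_square less_1_mult)
  then show ?thesis
    using summable_mult2[OF summable_invariant_power[of 1], of "\<bar>a\<bar>"] by (simp add: L1_def)
qed

lemma L1_summable: "L1 f \<Longrightarrow> summable (\<lambda>k. \<pi> k * f k)"
  unfolding L1_def by (rule summable_comparison_test[rotated]) (auto simp: abs_mult)

lemma L1_bounded:
  assumes f: "L1 f" and le: "\<And>k. \<bar>g k\<bar> \<le> C * \<bar>f k\<bar>"
  shows "L1 g"
  unfolding L1_def
proof (rule summable_comparison_test')
  show "summable (\<lambda>k. C * (\<pi> k * \<bar>f k\<bar>))"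
    using f unfolding L1_def by (rule summable_mult)
  show "norm (\<pi> k * \<bar>g k\<bar>) \<le> C * (\<pi> k * \<bar>f k\<bar>)" for k
    using mult_left_mono[OF le[of k], of "\<pi> k"] by (simp add: mult.left_commute)
qed

lemma L1_add:
  assumes "L1 f" "L1 g" shows "L1 (\<lambda>k. f k + g k)"
  unfolding L1_def
proof (rule summable_comparison_test')
  show "summable (\<lambda>k. \<pi> k * \<bar>f k\<bar> + \<pi> k * \<bar>g k\<bar>)"
    using assms unfolding L1_def by (rule summable_add)
  show "norm (\<pi> k * \<bar>f k + g k\<bar>) \<le> \<pi> k * \<bar>f k\<bar> + \<pi> k * \<bar>g k\<bar>" for k
    using mult_left_mono[OF abs_triangle_ineq[of "f k" "g k"], of "\<pi> k"]
    by (simp add: distrib_left)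
qed

lemma L1_abs: "L1 (\<lambda>k. \<bar>f k\<bar>) \<longleftrightarrow> L1 f"
  by (simp add: L1_def)

lemma L1_diff: "L1 f \<Longrightarrow> L1 g \<Longrightarrow> L1 (\<lambda>k. f k - g k)"
  using L1_add[of f "\<lambda>k. - g k"] by (simp add: L1_def)

lemma mass_add:
  assumes "L1 f" "L1 g" shows "mass (\<lambda>k. f k + g k) = mass f + mass g"
  unfolding mass_def distrib_left
  by (rule suminf_add[symmetric]; rule L1_summable; rule assms)

lemma mass_diff:
  assumes "L1 f" "L1 g" shows "mass (\<lambda>k. f k - g k) = mass f - mass g"
  unfolding mass_def right_diff_distrib
  by (rule suminf_diff[symmetric]; rule L1_summable; rule assms)

lemma mass_mult:
  assumes "L1 f" shows "mass (\<lambda>k. a * f k) = a * mass f"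
  unfolding mass_def mult.left_commute[of _ a]
  by (rule suminf_mult[OF L1_summable[OF assms]])

lemma mass_mono: "L1 f \<Longrightarrow> L1 g \<Longrightarrow> (\<And>k. f k \<le> g k) \<Longrightarrow> mass f \<le> mass g"
  unfolding mass_def by (intro suminf_le L1_summable mult_left_mono) auto

lemma mass_abs:
  assumes f: "L1 f" shows "\<bar>mass f\<bar> \<le> mass (\<lambda>k. \<bar>f k\<bar>)"
proof -
  have a: "L1 (\<lambda>k. \<bar>f k\<bar>)" using f by (simp add: L1_abs)
  have "mass f \<le> mass (\<lambda>k. \<bar>f k\<bar>)"
    by (rule mass_mono[OF f a]) simp
  moreover have "mass (\<lambda>k. - 1 * f k) \<le> mass (\<lambda>k. \<bar>f k\<bar>)"
    by (rule mass_mono[OF L1_bounded[OF f, of _ 1] a]) auto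
  ultimately show ?thesis unfolding mass_mult[OF f] by linarith
qed

lemma nonneg_le_mass: "L1 f \<Longrightarrow> (\<And>k. 0 \<le> f k) \<Longrightarrow> f 0 \<le> mass f"
  using sum_le_suminf[OF L1_summable, of f "{0}"] by (simp add: mass_def)

lemma mass_one_pos: "mass (\<lambda>_. 1) > 0"
  using nonneg_le_mass[OF L1_const, of 1] by simp

text \<open>
  Invariance of \<open>\<pi>\<close>. By detailed balance the contribution of the up steps is \<open>A (Suc k)\<close> and that
  of the down steps is \<open>C k\<close>; undoing the two shifts of the summation index turns each into a multiple
  of \<open>\<pi> k * f k\<close>, and the coefficients add up to \<open>lam\<close>.
\<close>
lemma sums_mass_step:
  assumes f: "L1 f"
  shows "(\<lambda>k. \<pi> k * step f k) sums mass f"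
proof -
  define A where "A k = u * (1 - q ^ k) * (\<pi> k * f k)" for k
  define B where "B k = (2 + u * q ^ k) * (\<pi> k * f k)" for k
  define C where "C k = (if k = 0 then 0 else \<pi> (k - 1) / u * f (k - 1))" for k
  have s: "L1 (\<lambda>k. c k * f k)" if "\<And>k. \<bar>c k\<bar> \<le> 2 + u" for c :: "nat \<Rightarrow> real"
    by (rule L1_bounded[OF f, of _ "2 + u"]) (auto simp: abs_mult intro!: mult_right_mono that)
  have "L1 (\<lambda>k. (u * (1 - q ^ k)) * f k)"
  proof (rule s)
    show "\<bar>u * (1 - q ^ k)\<bar> \<le> 2 + u" for k
    proof -
      have "0 \<le> u * (1 - q ^ k)" "u * (1 - q ^ k) \<le> u"
        using q_power_bounds[of k] u0 by (simp_all add: mult_left_le)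
      then show ?thesis using u0 by linarith
    qed
  qed
  from L1_summable[OF this] have A: "summable A" by (simp add: A_def[abs_def] mult_ac)
  have "L1 (\<lambda>k. (2 + u * q ^ k) * f k)"
  proof (rule s)
    show "\<bar>2 + u * q ^ k\<bar> \<le> 2 + u" for k
      using mult_left_le[of "q ^ k" u] q_power_bounds[of k] u0 by simp
  qed
  from L1_summable[OF this] have B: "summable B" by (simp add: B_def[abs_def] mult_ac)
  have A': "(\<lambda>k. A (Suc k)) sums suminf A"
    using summable_sums[OF A] by (simp add: sums_Suc_iff[of A] A_def[of 0])
  have mf: "(\<lambda>k. \<pi> k * f k) sums mass f"
    unfolding mass_def by (rule summable_sums[OF L1_summable[OF f]])
  have "(\<lambda>k. C (Suc k)) sums (mass f / u)"
    using sums_divide[OF mf, of u] by (simp add: C_def)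
  then have C: "C sums (mass f / u)"
    by (simp add: sums_Suc_iff[of C] C_def[of 0])
  have step: "\<pi> k * step f k = (A (Suc k) + B k + C k) / lam" for k
  proof -
    have "A (Suc k) = \<pi> k / u * f (Suc k)"
      unfolding A_def detailed_balance[symmetric] by (simp only: mult_ac)
    moreover have "C k = \<pi> k * (u * (1 - q ^ k)) * f (k - 1)"
      using detailed_balance[of "k - 1"] by (cases k) (auto simp: C_def)
    ultimately show ?thesis
      by (simp add: step_def site_op_def B_def algebra_simps)
  qed
  have "(\<lambda>k. A (Suc k) + B k + C k) sums (suminf A + suminf B + mass f / u)"
    by (intro sums_add A' C summable_sums[OF B])
  also have "suminf A + suminf B + mass f / u = lam * mass f"
  proof -
    have "(\<lambda>k. A k + B k + \<pi> k * f k / u) sums (suminf A + suminf B + mass f / u)"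
      by (intro sums_add sums_divide mf summable_sums A B)
    moreover have "(\<lambda>k. A k + B k + \<pi> k * f k / u) = (\<lambda>k. lam * (\<pi> k * f k))"
      by (auto simp: A_def B_def lam_eq algebra_simps)
    ultimately show ?thesis
      using sums_unique2[OF _ sums_mult[OF mf, of lam]] by simp
  qed
  finally show ?thesis
    unfolding step using sums_divide[of "\<lambda>k. A (Suc k) + B k + C k" "lam * mass f" lam] lam_pos by simp
qed

lemma mass_step: "L1 f \<Longrightarrow> mass (step f) = mass f"
  using sums_mass_step by (simp add: mass_def sums_iff)

lemma site_op_mono: "(\<And>k. f k \<le> g k) \<Longrightarrow> site_op q u x f k \<le> site_op q u x g k"
  using q_power_bounds u0 by (auto simp: site_op_def intro!: add_mono mult_left_mono divide_right_mono)

lemma word_op_mono: "(\<And>k. f k \<le> g k) \<Longrightarrow> word_op q u xs f k \<le> word_op q u xs g k"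
  by (induction xs arbitrary: k) (auto intro!: site_op_mono)

lemma word_op_abs: "\<bar>word_op q u xs f k\<bar> \<le> word_op q u xs (\<lambda>k. \<bar>f k\<bar>) k"
proof -
  have "word_op q u xs f k \<le> word_op q u xs (\<lambda>k. \<bar>f k\<bar>) k"
    by (rule word_op_mono) simp
  moreover have "word_op q u xs (\<lambda>k. - 1 * f k) k \<le> word_op q u xs (\<lambda>k. \<bar>f k\<bar>) k"
    by (rule word_op_mono) simp
  ultimately show ?thesis unfolding word_op_scale by simp
qed

lemma step_linear: "step (\<lambda>k. a * f k + b * g k) = (\<lambda>k. a * step f k + b * step g k)"
  by (auto simp: step_def site_op_linear add_divide_distrib algebra_simps)

lemma step_mono: "(\<And>k. f k \<le> g k) \<Longrightarrow> step f k \<le> step g k"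
  unfolding step_def using lam_pos by (intro divide_right_mono add_mono site_op_mono) auto

lemma step_const: "step (\<lambda>_. a) = (\<lambda>_. a)"
proof
  fix k
  have "site_op q u True (\<lambda>_. a) k + site_op q u False (\<lambda>_. a) k = lam * a"
    by (simp add: site_op_def lam_eq algebra_simps)
  then show "step (\<lambda>_. a) k = a" using lam_pos by (simp add: step_def)
qed

lemma steps_linear:
  "(step ^^ n) (\<lambda>k. a * f k + b * g k) = (\<lambda>k. a * (step ^^ n) f k + b * (step ^^ n) g k)"
  by (induction n) (auto simp: step_linear)

lemma steps_diff: "(step ^^ n) (\<lambda>k. f k - g k) k = (step ^^ n) f k - (step ^^ n) g k"
  using steps_linear[of n 1 f "-1" g] by (simp add: fun_eq_iff)

lemma steps_mono: "(\<And>k. f k \<le> g k) \<Longrightarrow> (step ^^ n) f k \<le> (step ^^ n) g k"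
  by (induction n arbitrary: k) (auto intro!: step_mono)

lemma steps_const: "(step ^^ n) (\<lambda>_. a) = (\<lambda>_. a)"
  by (induction n) (auto simp: step_const)

lemma steps_abs: "\<bar>(step ^^ n) f k\<bar> \<le> (step ^^ n) (\<lambda>k. \<bar>f k\<bar>) k"
proof -
  have "(step ^^ n) f k \<le> (step ^^ n) (\<lambda>k. \<bar>f k\<bar>) k"
    by (rule steps_mono) simp
  moreover have "(step ^^ n) (\<lambda>k. 0 - f k) k \<le> (step ^^ n) (\<lambda>k. \<bar>f k\<bar>) k"
    by (rule steps_mono) simp
  ultimately show ?thesis unfolding steps_diff steps_const by simp
qed

lemma L1_step:
  assumes "L1 f" shows "L1 (step f)"
proof -
  have "L1 (\<lambda>k. \<bar>f k\<bar>)" using assms by (simp add: L1_abs)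
  from sums_mass_step[OF this] have "summable (\<lambda>k. \<pi> k * step (\<lambda>k. \<bar>f k\<bar>) k)"
    by (rule sums_summable)
  moreover have "\<bar>step f k\<bar> \<le> step (\<lambda>k. \<bar>f k\<bar>) k" for k
    using steps_abs[of 1 f k] by simp
  ultimately show ?thesis
    unfolding L1_def
    by (elim summable_comparison_test'[of _ 0]) (simp add: abs_mult mult_left_mono)
qed

lemma L1_steps: "L1 f \<Longrightarrow> L1 ((step ^^ n) f)"
  by (induction n) (auto simp: L1_step)

lemma mass_steps: "L1 f \<Longrightarrow> mass ((step ^^ n) f) = mass f"
  by (induction n) (auto simp: mass_step L1_steps)

lemma mass_abs_steps_le:
  assumes "L1 f" shows "mass (\<lambda>k. \<bar>(step ^^ n) f k\<bar>) \<le> mass (\<lambda>k. \<bar>f k\<bar>)"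
  using mass_mono[of "\<lambda>k. \<bar>(step ^^ n) f k\<bar>" "(step ^^ n) (\<lambda>k. \<bar>f k\<bar>)"] assms
  by (simp add: L1_abs L1_steps steps_abs mass_steps)

text \<open>
  The law of the chain started at 0 is dominated by \<open>\<pi>\<close> at all times, because \<open>\<pi> 0 = 1\<close> and \<open>\<pi>\<close> is
  invariant. This is what makes all later estimates uniform in the length of the interval.
\<close>
lemma steps_0_le_mass:
  assumes "L1 f" "\<And>k. 0 \<le> f k" shows "(step ^^ n) f 0 \<le> mass f"
  using nonneg_le_mass[OF L1_steps[OF assms(1)], of n] mass_steps[OF assms(1), of n]
    steps_mono[of "\<lambda>_. 0" f n] assms(2) by (simp add: steps_const)

section \<open>Ergodicity of the hidden chain\<close>

text \<open>
  The discrete gradient of \<open>step f\<close> is a nonnegative combination of neighbouring gradients of \<open>f\<close>.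
  Against the weight \<open>c\<^sup>k\<close> the combination far from 0 has total coefficient \<open>2 + u / c + c / u\<close>,
  which is below \<open>lam\<close> exactly when \<open>1 < c < u\<^sup>2\<close>. Close to 0 the
  coefficient differs from this by \<open>- u q\<^sup>k (1 / c - q)\<close>, which is not positive as soon as
  \<open>c q \<le> 1\<close>.
\<close>
lemma step_gradient:
  assumes c: "1 < c" "c < u\<^sup>2" "c * q \<le> 1" and B: "0 \<le> B"
    and f: "\<And>k. \<bar>f (Suc k) - f k\<bar> \<le> B * c ^ k"
  shows "\<bar>step f (Suc k) - step f k\<bar> \<le> B * ((2 + u / c + c / u) / lam) * c ^ k"
proof -
  define g where "g k = f (Suc k) - f k" for k
  have g: "\<bar>g k\<bar> \<le> B * c ^ k" for k
    using f by (simp add: g_def)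
  have "lam * (step f (Suc k) - step f k)
      = g (Suc k) / u + (2 + u * q ^ Suc k) * g k + u * (1 - q ^ k) * g (k - 1)"
    using lam_pos by (cases k) (simp_all add: step_def site_op_def g_def algebra_simps diff_divide_distrib add_divide_distrib)
  then have "\<bar>lam * (step f (Suc k) - step f k)\<bar>
      \<le> \<bar>g (Suc k) / u\<bar> + \<bar>(2 + u * q ^ Suc k) * g k\<bar> + \<bar>u * (1 - q ^ k) * g (k - 1)\<bar>"
    by linarith
  also have "\<dots> = \<bar>g (Suc k)\<bar> / u + (2 + u * q ^ Suc k) * \<bar>g k\<bar> + u * (1 - q ^ k) * \<bar>g (k - 1)\<bar>"
    using u0 q_power_bounds[of k] q_power_bounds[of "Suc k"]
    by (simp add: abs_mult add_pos_nonneg abs_of_nonneg del: power_Suc)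
  also have "\<dots> \<le> (B * c ^ Suc k) / u + (2 + u * q ^ Suc k) * (B * c ^ k) + u * (1 - q ^ k) * (B * c ^ k / c)"
  proof -
    have "u * (1 - q ^ k) * \<bar>g (k - 1)\<bar> \<le> u * (1 - q ^ k) * (B * c ^ k / c)"
    proof (cases k)
      case (Suc j)
      then show ?thesis
        using g[of j] c u0 q_power_bounds[of k] by (intro mult_left_mono) auto
    qed simp
    moreover have "\<bar>g (Suc k)\<bar> / u \<le> B * c ^ Suc k / u"
      using u0 by (intro divide_right_mono g) simp
    moreover have "(2 + u * q ^ Suc k) * \<bar>g k\<bar> \<le> (2 + u * q ^ Suc k) * (B * c ^ k)"
      using u0 q_power_bounds[of "Suc k"] by (intro mult_left_mono g) (simp del: power_Suc)
    ultimately show ?thesis by linarith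
  qed
  also have "\<dots> = B * c ^ k * (2 + u / c + c / u) - B * c ^ k * (u * q ^ k * (1 / c - q))"
    by (simp add: algebra_simps diff_divide_distrib)
  also have "\<dots> \<le> B * c ^ k * (2 + u / c + c / u)"
  proof -
    have "q \<le> 1 / c" using c by (simp add: field_simps)
    then show ?thesis using B c u0 q_power_bounds[of k] by simp
  qed
  finally have "\<bar>step f (Suc k) - step f k\<bar> * lam \<le> B * c ^ k * (2 + u / c + c / u)"
    unfolding abs_mult abs_of_pos[OF lam_pos] by (simp only: mult.commute)
  then have "\<bar>step f (Suc k) - step f k\<bar> \<le> B * c ^ k * (2 + u / c + c / u) / lam"
    using lam_pos by (simp only: pos_le_divide_eq)
  then show ?thesis by (simp only: mult_ac times_divide_eq_left times_divide_eq_right)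
qed

lemma steps_gradient:
  assumes c: "1 < c" "c < u\<^sup>2" "c * q \<le> 1" and B: "0 \<le> B"
    and f: "\<And>k. \<bar>f (Suc k) - f k\<bar> \<le> B * c ^ k"
  shows "\<bar>(step ^^ n) f (Suc k) - (step ^^ n) f k\<bar> \<le> B * ((2 + u / c + c / u) / lam) ^ n * c ^ k"
proof (induction n arbitrary: k)
  case 0
  then show ?case using f by simp
next
  case (Suc n)
  have "0 \<le> B * ((2 + u / c + c / u) / lam) ^ n"
    using B c u0 lam_pos by simp
  from step_gradient[OF c this Suc] show ?case
    by (simp add: mult_ac)
qed

lemma contraction_factor_less_1:
  assumes c: "1 < c" "c < u\<^sup>2"
  shows "(2 + u / c + c / u) / lam < 1"
proof -
  have "0 < (c - 1) * (u / c - 1 / u)"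
    using c u0 by (intro mult_pos_pos) (simp_all add: field_simps power2_eq_square)
  also have "\<dots> = u + 1 / u - u / c - c / u"
    using c u0 by (simp add: field_simps)
  finally show ?thesis using lam_pos by (simp add: lam_eq)
qed

lemma deviation_from_gradient:
  fixes f :: "nat \<Rightarrow> real"
  assumes c: "1 < c" and f: "\<And>k. \<bar>f (Suc k) - f k\<bar> \<le> B * c ^ k"
  shows "\<bar>f k - f 0\<bar> \<le> B / (c - 1) * (c ^ k - 1)"
proof (induction k)
  case 0
  then show ?case by simp
next
  case (Suc k)
  have "\<bar>f (Suc k) - f 0\<bar> \<le> B * c ^ k + B / (c - 1) * (c ^ k - 1)"
    using Suc f[of k] by linarith
  also have "\<dots> = B / (c - 1) * (c ^ Suc k - 1)"
    using c by (simp add: field_simps)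
  finally show ?case .
qed

lemma exists_weight_base: "\<exists>c. 1 < c \<and> c < u\<^sup>2 \<and> c * q \<le> 1"
proof -
  \<comment> \<open>The halving in the second argument is what gives \<open>c q \<le> 1\<close>: the bound becomes \<open>(1 - q) (2 - q) \<ge> 0\<close>.\<close>
  define c where "c = 1 + min (u\<^sup>2 - 1) (1 - q) / 2"
  have "1 < u\<^sup>2" using u1 by (simp add: power2_eq_square less_1_mult)
  then have "1 < c" "c < u\<^sup>2" using q1 by (auto simp: c_def min_def field_simps)
  moreover have "c * q \<le> (1 + (1 - q) / 2) * q"
    using q0 by (intro mult_right_mono) (auto simp: c_def)
  moreover have "(1 + (1 - q) / 2) * q \<le> 1"
  proof -
    have "0 \<le> (1 - q) * (2 - q)" using q1 by simp
    moreover have "(1 + (1 - q) / 2) * q = 1 - (1 - q) * (2 - q) / 2"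
      by (simp add: algebra_simps diff_divide_distrib add_divide_distrib)
    ultimately show ?thesis by linarith
  qed
  ultimately show ?thesis by (intro exI[of _ c] conjI) linarith+
qed

definition mean :: "(nat \<Rightarrow> real) \<Rightarrow> real" where
  "mean f = mass f / mass (\<lambda>_. 1)"

lemma mass_const: "mass (\<lambda>_. a) = a * mass (\<lambda>_. 1)"
  using mass_mult[OF L1_const, of a 1] by simp

lemma abs_mean_le:
  assumes "L1 f" shows "mass (\<lambda>_. \<bar>mean f\<bar>) \<le> mass (\<lambda>k. \<bar>f k\<bar>)"
  using mass_abs[OF assms] mass_one_pos
  by (subst mass_const) (simp add: mean_def)

lemma mass_abs_triangle:
  assumes "L1 f" "L1 g"
  shows "mass (\<lambda>k. \<bar>f k + g k\<bar>) \<le> mass (\<lambda>k. \<bar>f k\<bar>) + mass (\<lambda>k. \<bar>g k\<bar>)"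
proof -
  have "mass (\<lambda>k. \<bar>f k + g k\<bar>) \<le> mass (\<lambda>k. \<bar>f k\<bar> + \<bar>g k\<bar>)"
    by (rule mass_mono) (use assms in \<open>auto simp: L1_abs intro!: L1_add\<close>)
  also have "\<dots> = mass (\<lambda>k. \<bar>f k\<bar>) + mass (\<lambda>k. \<bar>g k\<bar>)"
    by (rule mass_add) (use assms in \<open>auto simp: L1_abs\<close>)
  finally show ?thesis .
qed

text \<open>
  The mean may be replaced by any other constant at the cost of a factor 2, so it need not be known
  when the gradient estimate is applied.
\<close>
lemma deviation_from_mean_le:
  assumes "L1 f"
  shows "mass (\<lambda>k. \<bar>f k - mean f\<bar>) \<le> 2 * mass (\<lambda>k. \<bar>f k - a\<bar>)"
proof -
  have fa: "L1 (\<lambda>k. f k - a)" using assms by (intro L1_diff L1_const)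
  have "mean (\<lambda>k. f k - a) = mean f - a"
    using mass_one_pos by (simp add: mean_def mass_diff[OF assms L1_const] mass_const[of a] diff_divide_distrib)
  with abs_mean_le[OF fa] have "mass (\<lambda>_. \<bar>a - mean f\<bar>) \<le> mass (\<lambda>k. \<bar>f k - a\<bar>)"
    by (simp add: abs_minus_commute)
  moreover have "mass (\<lambda>k. \<bar>(f k - a) + (a - mean f)\<bar>) \<le> mass (\<lambda>k. \<bar>f k - a\<bar>) + mass (\<lambda>_. \<bar>a - mean f\<bar>)"
    by (rule mass_abs_triangle[OF fa L1_const])
  ultimately show ?thesis by simp
qed

text \<open>
  For bounded \<open>f\<close> the gradient estimate gives a geometric rate, since \<open>c\<^sup>k\<close> is integrable for
  \<open>c < u\<^sup>2\<close>.
\<close>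
lemma ergodic_bounded:
  assumes B: "\<And>k. \<bar>f k\<bar> \<le> B"
  shows "(\<lambda>n. mass (\<lambda>k. \<bar>(step ^^ n) f k - mean f\<bar>)) \<longlonglongrightarrow> 0"
proof -
  obtain c where c: "1 < c" "c < u\<^sup>2" "c * q \<le> 1"
    using exists_weight_base by blast
  define r where "r = (2 + u / c + c / u) / lam"
  have r: "0 \<le> r" "r < 1"
    using contraction_factor_less_1[OF c(1,2)] c u0 lam_pos by (simp_all add: r_def)
  have f: "L1 f"
  proof (rule L1_bounded[OF L1_const[of B], of _ 1])
    show "\<bar>f k\<bar> \<le> 1 * \<bar>B\<bar>" for k using B[of k] by linarith
  qed
  have B0: "0 \<le> 2 * B" using B[of 0] by simp
  have grad: "\<bar>f (Suc k) - f k\<bar> \<le> 2 * B * c ^ k" for k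
  proof -
    have "\<bar>f (Suc k) - f k\<bar> \<le> 2 * B" using B[of k] B[of "Suc k"] by linarith
    also have "\<dots> \<le> 2 * B * c ^ k"
      using mult_left_mono[OF one_le_power[of c k] B0] c by simp
    finally show ?thesis .
  qed
  define K where "K = 2 * (2 * B / (c - 1) * mass (\<lambda>k. c ^ k))"
  have "\<bar>mass (\<lambda>k. \<bar>(step ^^ n) f k - mean f\<bar>)\<bar> \<le> K * r ^ n" for n
  proof -
    let ?g = "(step ^^ n) f"
    have g: "L1 ?g" by (rule L1_steps[OF f])
    have cL: "L1 (\<lambda>k. c ^ k)" using L1_power[of c] c by simp
    have dev: "\<bar>?g k - ?g 0\<bar> \<le> 2 * B * r ^ n / (c - 1) * c ^ k" for k
    proof -
      have "\<bar>?g k - ?g 0\<bar> \<le> 2 * B * r ^ n / (c - 1) * (c ^ k - 1)"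
        using deviation_from_gradient[OF c(1) steps_gradient[OF c B0 grad]] by (simp add: r_def)
      also have "\<dots> \<le> 2 * B * r ^ n / (c - 1) * c ^ k"
        using B0 r c by (intro mult_left_mono) auto
      finally show ?thesis .
    qed
    have "mean ?g = mean f" by (simp add: mean_def mass_steps[OF f])
    with deviation_from_mean_le[OF g, of "?g 0"]
    have "mass (\<lambda>k. \<bar>?g k - mean f\<bar>) \<le> 2 * mass (\<lambda>k. \<bar>?g k - ?g 0\<bar>)" by simp
    also have "mass (\<lambda>k. \<bar>?g k - ?g 0\<bar>) \<le> mass (\<lambda>k. 2 * B * r ^ n / (c - 1) * c ^ k)"
    proof (rule mass_mono[OF _ _ dev])
      show "L1 (\<lambda>k. \<bar>?g k - ?g 0\<bar>)"
        unfolding L1_abs by (intro L1_diff g L1_const)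
      show "L1 (\<lambda>k. 2 * B * r ^ n / (c - 1) * c ^ k)"
        by (rule L1_bounded[OF cL, of _ "\<bar>2 * B * r ^ n / (c - 1)\<bar>"]) (simp only: abs_mult order_refl)
    qed
    also have "\<dots> = 2 * B * r ^ n / (c - 1) * mass (\<lambda>k. c ^ k)"
      by (rule mass_mult[OF cL])
    finally have "mass (\<lambda>k. \<bar>?g k - mean f\<bar>) \<le> K * r ^ n"
      by (simp add: K_def mult_ac)
    moreover have "0 \<le> mass (\<lambda>k. \<bar>?g k - mean f\<bar>)"
      using mass_abs[OF L1_diff[OF g L1_const], of "mean f"] by linarith
    ultimately show ?thesis by simp
  qed
  then have bound: "\<forall>\<^sub>F n in sequentially. norm (mass (\<lambda>k. \<bar>(step ^^ n) f k - mean f\<bar>)) \<le> K * r ^ n"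
    by simp
  have "(\<lambda>n. K * r ^ n) \<longlonglongrightarrow> 0"
    by (rule tendsto_mult_right_zero) (rule LIMSEQ_realpow_zero[OF r])
  then show ?thesis by (rule Lim_null_comparison[OF bound])
qed

definition cutoff :: "nat \<Rightarrow> (nat \<Rightarrow> real) \<Rightarrow> nat \<Rightarrow> real" where
  "cutoff L f k = (if k < L then f k else 0)"

lemma cutoff_tail:
  assumes f: "L1 f" and e: "e > 0"
  shows "\<exists>L. mass (\<lambda>k. \<bar>f k - cutoff L f k\<bar>) < e"
proof -
  have s: "summable (\<lambda>k. \<pi> k * \<bar>f k\<bar>)" using f by (simp add: L1_def)
  from suminf_exist_split[OF e s] obtain L where L: "norm (\<Sum>i. \<pi> (i + L) * \<bar>f (i + L)\<bar>) < e"
    by blast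
  have g: "summable (\<lambda>k. \<pi> k * \<bar>f k - cutoff L f k\<bar>)"
    by (rule summable_comparison_test'[OF s, of 0]) (auto simp: cutoff_def)
  have "mass (\<lambda>k. \<bar>f k - cutoff L f k\<bar>) = (\<Sum>i. \<pi> (i + L) * \<bar>f (i + L) - cutoff L f (i + L)\<bar>)"
    unfolding mass_def by (subst suminf_split_initial_segment[OF g, of L]) (simp add: cutoff_def)
  also have "\<dots> = (\<Sum>i. \<pi> (i + L) * \<bar>f (i + L)\<bar>)"
    by (simp add: cutoff_def)
  finally show ?thesis using L by (intro exI[of _ L]) simp
qed

text \<open>
  The functions of interest are \<open>t\<^sup>k\<close> with possibly \<open>t < -1\<close>, which are unbounded and may
  grow faster than the weights admitted in the gradient estimate. Since \<open>step\<close> is a contraction of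
  the weighted \<open>L\<^sup>1\<close> space, convergence extends from truncated functions to all integrable ones.
\<close>
lemma ergodic:
  assumes f: "L1 f"
  shows "(\<lambda>n. mass (\<lambda>k. \<bar>(step ^^ n) f k - mean f\<bar>)) \<longlonglongrightarrow> 0"
proof (rule LIMSEQ_I)
  fix e :: real assume e: "e > 0"
  from cutoff_tail[OF f, of "e / 3"] e obtain L
    where L: "mass (\<lambda>k. \<bar>f k - cutoff L f k\<bar>) < e / 3" by auto
  let ?t = "cutoff L f" and ?d = "\<lambda>k. f k - cutoff L f k"
  have bdd: "\<bar>?t k\<bar> \<le> (\<Sum>j<L. \<bar>f j\<bar>)" for k
    using member_le_sum[of k "{..<L}" "\<lambda>j. \<bar>f j\<bar>"] by (auto simp: cutoff_def sum_nonneg)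
  have t: "L1 ?t" by (rule L1_bounded[OF f, of _ 1]) (simp add: cutoff_def)
  have d: "L1 ?d" by (rule L1_diff[OF f t])
  have "(\<lambda>n. mass (\<lambda>k. \<bar>(step ^^ n) ?t k - mean ?t\<bar>)) \<longlonglongrightarrow> 0"
    by (rule ergodic_bounded[OF bdd])
  moreover have "0 < e / 3" using e by simp
  ultimately obtain n0
    where "\<forall>n\<ge>n0. norm (mass (\<lambda>k. \<bar>(step ^^ n) ?t k - mean ?t\<bar>) - 0) < e / 3"
    using LIMSEQ_D by blast
  then have n0: "\<bar>mass (\<lambda>k. \<bar>(step ^^ n) ?t k - mean ?t\<bar>)\<bar> < e / 3" if "n \<ge> n0" for n
    using that by simp
  show "\<exists>n0. \<forall>n\<ge>n0. norm (mass (\<lambda>k. \<bar>(step ^^ n) f k - mean f\<bar>) - 0) < e"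
  proof (intro exI[of _ n0] allI impI)
    fix n assume n: "n \<ge> n0"
    have mean: "mean ?d = mean f - mean ?t"
      by (simp add: mean_def mass_diff[OF f t] diff_divide_distrib)
    have eq: "(step ^^ n) f k - mean f = ((step ^^ n) ?t k - mean ?t) + ((step ^^ n) ?d k + - mean ?d)" for k
      unfolding steps_diff mean by simp
    have L1t: "L1 (\<lambda>k. (step ^^ n) ?t k - mean ?t)" and L1d: "L1 ((step ^^ n) ?d)"
      by (intro L1_diff L1_steps t d L1_const)+
    have "mass (\<lambda>k. \<bar>(step ^^ n) f k - mean f\<bar>)
        \<le> mass (\<lambda>k. \<bar>(step ^^ n) ?t k - mean ?t\<bar>) + mass (\<lambda>k. \<bar>(step ^^ n) ?d k + - mean ?d\<bar>)"
      unfolding eq by (intro mass_abs_triangle L1t L1_add L1d L1_const)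
    also have "mass (\<lambda>k. \<bar>(step ^^ n) ?d k + - mean ?d\<bar>)
        \<le> mass (\<lambda>k. \<bar>(step ^^ n) ?d k\<bar>) + mass (\<lambda>_. \<bar>- mean ?d\<bar>)"
      by (intro mass_abs_triangle L1d L1_const)
    also have "\<dots> \<le> mass (\<lambda>k. \<bar>?d k\<bar>) + mass (\<lambda>k. \<bar>?d k\<bar>)"
      using mass_abs_steps_le[OF d] abs_mean_le[OF d] by (intro add_mono) simp_all
    finally have "mass (\<lambda>k. \<bar>(step ^^ n) f k - mean f\<bar>) < e"
      using L n0[OF n] by linarith
    moreover have "0 \<le> mass (\<lambda>k. \<bar>(step ^^ n) f k - mean f\<bar>)"
      using mass_abs[OF L1_diff[OF L1_steps[OF f] L1_const], of n "mean f"] by linarith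
    ultimately show "norm (mass (\<lambda>k. \<bar>(step ^^ n) f k - mean f\<bar>) - 0) < e" by simp
  qed
qed

section \<open>Positivity of the limiting normalisation\<close>

text \<open>
  The generating function of \<open>\<pi>\<close> is the \<open>q\<close>-exponential
  \<open>\<Prod>\<^sub>j 1 / (1 - q\<^sup>j t / u\<^sup>2)\<close>; the functional equation peels off its factor \<open>j = 0\<close>.
\<close>
lemma mass_power_functional_equation:
  assumes t: "\<bar>t\<bar> < u\<^sup>2"
  shows "mass (\<lambda>k. (q * t) ^ k) = (1 - t / u\<^sup>2) * mass (\<lambda>k. t ^ k)"
proof -
  have s: "summable (\<lambda>k. \<pi> k * t ^ k)"
    by (rule L1_summable[OF L1_power[OF t]])
  have "\<bar>q * t\<bar> \<le> \<bar>t\<bar>" using q0 q1 by (simp add: abs_mult mult_left_le_one_le)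
  then have s': "summable (\<lambda>k. \<pi> k * (q * t) ^ k)"
    by (intro L1_summable L1_power) (use t in linarith)
  let ?d = "\<lambda>k. \<pi> k * t ^ k - \<pi> k * (q * t) ^ k"
  have "?d (Suc k) = t / u\<^sup>2 * (\<pi> k * t ^ k)" for k
  proof -
    have "?d (Suc k) = \<pi> (Suc k) * (1 - q ^ Suc k) * t ^ Suc k"
      unfolding power_mult_distrib by (simp only: algebra_simps)
    also have "\<pi> (Suc k) * (1 - q ^ Suc k) = \<pi> k / u\<^sup>2"
      using detailed_balance[of k] u0 by (simp add: field_simps power2_eq_square)
    finally show ?thesis by (simp add: mult_ac)
  qed
  moreover have "suminf ?d = ?d 0 + (\<Sum>k. ?d (Suc k))"
    using suminf_split_head[OF summable_diff[OF s s']] by simp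
  ultimately have "suminf ?d = t / u\<^sup>2 * (\<Sum>k. \<pi> k * t ^ k)"
    using suminf_mult[OF s, of "t / u\<^sup>2"] by simp
  then have "(\<Sum>k. \<pi> k * t ^ k) - (\<Sum>k. \<pi> k * (q * t) ^ k) = t / u\<^sup>2 * (\<Sum>k. \<pi> k * t ^ k)"
    using suminf_diff[OF s s'] by simp
  then show ?thesis by (simp add: mass_def algebra_simps)
qed

text \<open>
  Positivity is not evident for negative \<open>t\<close>. It holds near \<open>t = 0\<close> by continuity, hence at
  \<open>q\<^sup>n t\<close> for large \<open>n\<close>, and each use of the functional equation divides by a positive factor.
\<close>
lemma mass_power_pos:
  assumes t: "\<bar>t\<bar> < u\<^sup>2"
  shows "mass (\<lambda>k. t ^ k) > 0"
proof -
  have small: "\<bar>q ^ n * t\<bar> < u\<^sup>2" for n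
    using t q_power_bounds[of n] mult_right_mono[of "q ^ n" 1 "\<bar>t\<bar>"] by (simp add: abs_mult)
  have descend: "mass (\<lambda>k. (q ^ n * t) ^ k) > 0 \<Longrightarrow> mass (\<lambda>k. t ^ k) > 0" for n
  proof (induction n)
    case (Suc n)
    have "q ^ n * t / u\<^sup>2 < 1" using small[of n] u0 by simp
    with Suc.prems mass_power_functional_equation[OF small[of n]]
    have "mass (\<lambda>k. (q ^ n * t) ^ k) > 0"
      by (simp add: mult.assoc zero_less_mult_iff)
    then show ?case by (rule Suc.IH)
  qed simp
  have "isCont (\<lambda>x. \<Sum>k. \<pi> k * x ^ k) 0"
    by (rule isCont_powser[OF summable_invariant_power[of 1]]) (use u1 in \<open>auto simp: power2_eq_square less_1_mult\<close>)
  moreover have "(\<lambda>n. q ^ n * t) \<longlonglongrightarrow> 0"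
    by (rule tendsto_mult_left_zero) (rule LIMSEQ_realpow_zero[OF q0 q1])
  ultimately have "(\<lambda>n. mass (\<lambda>k. (q ^ n * t) ^ k)) \<longlonglongrightarrow> (\<Sum>k. \<pi> k * 0 ^ k)"
    unfolding mass_def by (rule isCont_tendsto_compose)
  also have "(\<Sum>k. \<pi> k * 0 ^ k) = 1" by (simp add: powser_zero)
  finally have "\<forall>\<^sub>F n in sequentially. mass (\<lambda>k. (q ^ n * t) ^ k) > 0"
    by (rule order_tendstoD(1)) simp
  then show ?thesis using descend by (auto simp: eventually_sequentially)
qed

lemma mean_power_pos: "\<bar>t\<bar> < u\<^sup>2 \<Longrightarrow> mean (\<lambda>k. t ^ k) > 0"
  unfolding mean_def by (intro divide_pos_pos mass_power_pos mass_one_pos)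

end

section \<open>Marginals and total variation\<close>

lemma configs_Suc:
  "configs {1..Suc n} = configs {1..n} \<union> (\<lambda>\<eta>. \<eta>(Suc n := True)) ` configs {1..n}" (is "?L = ?A \<union> ?B")
proof (intro equalityI subsetI)
  fix \<eta> assume \<eta>: "\<eta> \<in> ?L"
  show "\<eta> \<in> ?A \<union> ?B"
  proof (cases "\<eta> (Suc n)")
    case True
    then have "\<eta> = (\<eta>(Suc n := False))(Suc n := True)" by (simp add: fun_upd_idem)
    moreover have "\<eta>(Suc n := False) \<in> configs {1..n}"
      using \<eta> by (auto simp: configs_def PiE_dflt_def)
    ultimately show ?thesis by blast
  next
    case False
    with \<eta> have "\<eta> \<in> configs {1..n}"
      by (auto simp: configs_def PiE_dflt_def) (metis le_SucE)
    then show ?thesis by simp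
  qed
qed (auto simp: configs_def PiE_dflt_def)

lemma sum_configs_Suc:
  "(\<Sum>\<eta>\<in>configs {1..Suc n}. F \<eta>) = (\<Sum>\<eta>\<in>configs {1..n}. F \<eta> + F (\<eta>(Suc n := True)))"
proof -
  have last: "\<not> \<eta> (Suc n)" if "\<eta> \<in> configs {1..n}" for \<eta>
    using that by (auto simp: configs_def PiE_dflt_def)
  have inj: "inj_on (\<lambda>\<eta>. \<eta>(Suc n := True)) (configs {1..n})"
    by (rule inj_on_inverseI[of _ "\<lambda>\<eta>. \<eta>(Suc n := False)"]) (simp add: last fun_upd_idem)
  have disj: "configs {1..n} \<inter> (\<lambda>\<eta>. \<eta>(Suc n := True)) ` configs {1..n} = {}"
    using last by fastforce
  have fin: "finite (configs {1..n})" by (simp add: finite_configs)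
  have "(\<Sum>\<eta>\<in>configs {1..Suc n}. F \<eta>)
      = (\<Sum>\<eta>\<in>configs {1..n}. F \<eta>) + (\<Sum>\<eta>\<in>(\<lambda>\<eta>. \<eta>(Suc n := True)) ` configs {1..n}. F \<eta>)"
    unfolding configs_Suc by (rule sum.union_disjoint[OF fin finite_imageI[OF fin] disj])
  then show ?thesis
    unfolding sum.reindex[OF inj] sum.distrib by (simp only: o_def)
qed

lemma configs_0: "configs {1..0} = {\<lambda>_. False}"
  by (auto simp: configs_def PiE_dflt_def)

lemma weight_0: "weight 0 q u f \<eta> = f 0"
  by (simp add: weight_def word_def)

lemma weight_Suc: "weight (Suc n) q u f \<eta> = weight n q u (site_op q u (\<eta> (Suc n)) f) \<eta>"
  by (simp add: weight_def word_def word_op_append)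

lemma weight_cong: "(\<And>x. x \<in> {1..n} \<Longrightarrow> \<eta> x = \<zeta> x) \<Longrightarrow> weight n q u f \<eta> = weight n q u f \<zeta>"
  using word_cong[of 1 "Suc n" \<eta> \<zeta>] by (simp add: weight_def)

lemma weight_scale: "weight n q u (\<lambda>k. a * f k) \<eta> = a * weight n q u f \<eta>"
  by (simp add: weight_def word_op_scale)

lemma weight_linear:
  "weight n q u (\<lambda>k. a * f k + b * g k) \<eta> = a * weight n q u f \<eta> + b * weight n q u g \<eta>"
  by (simp add: weight_def word_op_linear)

lemma pmf_map_finite:
  assumes "finite X" "set_pmf p \<subseteq> X"
  shows "pmf (map_pmf g p) y = (\<Sum>x | x \<in> X \<and> g x = y. pmf p x)"
proof -
  have "measure_pmf.prob p (g -` {y}) = measure_pmf.prob p {x \<in> X. g x = y}"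
    by (rule measure_pmf.finite_measure_eq_AE) (use assms in \<open>auto simp: AE_measure_pmf_iff\<close>)
  then show ?thesis
    using assms by (simp add: pmf_map measure_measure_pmf_finite)
qed

lemma tv_dist_nonneg: "0 \<le> tv_dist X p p'"
  by (simp add: tv_dist_def sum_nonneg)

lemma tv_dist_map_le:
  assumes fin: "finite X" "finite Y" and p: "set_pmf p \<subseteq> X" "set_pmf p' \<subseteq> X"
  shows "tv_dist Y (map_pmf g p) (map_pmf g p') \<le> tv_dist X p p'"
proof -
  have "(\<Sum>y\<in>Y. \<bar>pmf (map_pmf g p) y - pmf (map_pmf g p') y\<bar>)
      \<le> (\<Sum>y\<in>Y. \<Sum>x | x \<in> X \<and> g x = y. \<bar>pmf p x - pmf p' x\<bar>)"
    unfolding pmf_map_finite[OF fin(1) p(1)] pmf_map_finite[OF fin(1) p(2)] sum_subtractf[symmetric]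
    by (intro sum_mono sum_abs)
  also have "\<dots> = (\<Sum>x\<in>X. \<Sum>y | y \<in> Y \<and> g x = y. \<bar>pmf p x - pmf p' x\<bar>)"
    by (rule sum.swap_restrict) (use fin in auto)
  also have "\<dots> \<le> (\<Sum>x\<in>X. \<bar>pmf p x - pmf p' x\<bar>)"
  proof (intro sum_mono)
    fix x
    have "card {y \<in> Y. g x = y} \<le> card {g x}" by (rule card_mono) auto
    then show "(\<Sum>y | y \<in> Y \<and> g x = y. \<bar>pmf p x - pmf p' x\<bar>) \<le> \<bar>pmf p x - pmf p' x\<bar>"
      using mult_right_mono[of "real (card {y \<in> Y. g x = y})" 1 "\<bar>pmf p x - pmf p' x\<bar>"] by simp
  qed
  finally show ?thesis by (simp add: tv_dist_def)
qed

lemma set_pmf_marginal: "set_pmf (marginal I \<mu>) \<subseteq> configs I"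
  by (auto simp: marginal_def configs_def PiE_dflt_def)

lemma set_pmf_Ber: "finite I \<Longrightarrow> set_pmf (Ber I \<rho>) \<subseteq> configs I"
  using set_Pi_pmf_subset[of I False] by (auto simp: Ber_def configs_def PiE_dflt_def)

context hidden_chain
begin

lemma weight_abs: "\<bar>weight n q u f \<eta>\<bar> \<le> weight n q u (\<lambda>k. \<bar>f k\<bar>) \<eta>"
  by (simp add: weight_def word_op_abs)

text \<open>
  Summing over the occupation of the last site replaces its operator by \<open>D + E = lam * step\<close>. The
  marginal on the first \<open>b\<close> sites therefore keeps the operators of these sites and sees the remaining
  ones only through the \<open>n\<close>-step evolution of the boundary vector.
\<close>
lemma sum_weight_extensions:
  assumes \<zeta>: "\<zeta> \<in> configs {1..b}"
  shows "(\<Sum>\<eta> | \<eta> \<in> configs {1..b + n} \<and> (\<lambda>x. if x \<in> {1..b} then \<eta> x else False) = \<zeta>.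
            weight (b + n) q u f \<eta>) = lam ^ n * weight b q u ((step ^^ n) f) \<zeta>"
proof (induction n arbitrary: f)
  case 0
  have "{\<eta> \<in> configs {1..b}. (\<lambda>x. if x \<in> {1..b} then \<eta> x else False) = \<zeta>} = {\<zeta>}"
  proof -
    have id: "(\<lambda>x. if x \<in> {1..b} then \<eta> x else False) = \<eta>" if "\<eta> \<in> configs {1..b}" for \<eta>
      using that by (auto simp: configs_def PiE_dflt_def)
    have "((\<lambda>x. if x \<in> {1..b} then \<eta> x else False) = \<zeta>) = (\<eta> = \<zeta>)" if "\<eta> \<in> configs {1..b}" for \<eta>
      by (simp only: id[OF that])
    then have "{\<eta> \<in> configs {1..b}. (\<lambda>x. if x \<in> {1..b} then \<eta> x else False) = \<zeta>}
        = {\<eta> \<in> configs {1..b}. \<eta> = \<zeta>}"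
      by (intro Collect_cong conj_cong refl)
    also have "\<dots> = {\<zeta>}" using \<zeta> by (auto simp only: mem_Collect_eq)
    finally show ?thesis .
  qed
  then show ?case by simp
next
  case (Suc n)
  define R where "R \<eta> \<longleftrightarrow> (\<lambda>x. if x \<in> {1..b} then \<eta> x else False) = \<zeta>" for \<eta> :: "nat \<Rightarrow> bool"
  have R: "R (\<eta>(Suc (b + n) := True)) = R \<eta>" for \<eta>
  proof -
    have "(\<lambda>x. if x \<in> {1..b} then (\<eta>(Suc (b + n) := True)) x else False)
        = (\<lambda>x. if x \<in> {1..b} then \<eta> x else False)" by auto
    then show ?thesis by (simp only: R_def)
  qed
  have pair: "weight (Suc (b + n)) q u f \<eta> + weight (Suc (b + n)) q u f (\<eta>(Suc (b + n) := True))
      = lam * weight (b + n) q u (step f) \<eta>" if "\<eta> \<in> configs {1..b + n}" for \<eta>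
  proof -
    have "\<not> \<eta> (Suc (b + n))" using that by (auto simp: configs_def PiE_dflt_def)
    moreover have "weight (b + n) q u g (\<eta>(Suc (b + n) := True)) = weight (b + n) q u g \<eta>" for g
      by (rule weight_cong) auto
    moreover have "(\<lambda>k. lam * step f k) = (\<lambda>k. 1 * site_op q u True f k + 1 * site_op q u False f k)"
      using lam_pos by (auto simp: step_def)
    then have "lam * weight (b + n) q u (step f) \<eta>
        = weight (b + n) q u (site_op q u True f) \<eta> + weight (b + n) q u (site_op q u False f) \<eta>"
      unfolding weight_scale[symmetric] by (simp only: weight_linear)
    ultimately show ?thesis by (simp add: weight_Suc)
  qed
  have fin: "finite (configs {1..k})" for k by (simp add: finite_configs)
  have "(\<Sum>\<eta> | \<eta> \<in> configs {1..b + Suc n} \<and> R \<eta>. weight (b + Suc n) q u f \<eta>)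
      = (\<Sum>\<eta>\<in>configs {1..Suc (b + n)}. if R \<eta> then weight (Suc (b + n)) q u f \<eta> else 0)"
    by (subst sum.inter_filter[OF fin, symmetric]) simp
  also have "\<dots> = (\<Sum>\<eta>\<in>configs {1..b + n}. if R \<eta> then lam * weight (b + n) q u (step f) \<eta> else 0)"
    unfolding sum_configs_Suc R by (intro sum.cong) (auto simp: pair)
  also have "\<dots> = lam * (\<Sum>\<eta> | \<eta> \<in> configs {1..b + n} \<and> R \<eta>. weight (b + n) q u (step f) \<eta>)"
    by (subst sum.inter_filter[OF fin, symmetric]) (simp add: sum_distrib_left)
  also have "\<dots> = lam ^ Suc n * weight b q u ((step ^^ Suc n) f) \<zeta>"
    unfolding R_def Suc.IH by (simp add: funpow_swap1)
  finally show ?case by (simp only: R_def)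
qed

lemma sum_weight: "(\<Sum>\<eta>\<in>configs {1..n}. weight n q u f \<eta>) = lam ^ n * (step ^^ n) f 0"
proof -
  have "(\<lambda>_. False) \<in> configs {1..0}" by (simp only: configs_0) simp
  from sum_weight_extensions[OF this, of n f] show ?thesis
    by (simp add: weight_0)
qed

text \<open>
  Constants are eigenvectors of both \<open>D\<close> and \<open>E\<close>, so with the boundary vector 1 the matrix product
  factorises. This is where the density \<open>1 / (1 + u)\<close> comes from.
\<close>
lemma pmf_Ber_weight:
  assumes \<zeta>: "\<zeta> \<in> configs {1..b}"
  shows "pmf (Ber {1..b} (1 / (1 + u))) \<zeta> = weight b q u (\<lambda>_. 1) \<zeta> / lam ^ b"
proof -
  have site: "site_op q u x (\<lambda>_. 1) = (\<lambda>_. lam * pmf (bernoulli_pmf (1 / (1 + u))) x * 1)" for x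
  proof
    have "1 + 1 / u = lam * (1 / (1 + u))" "1 + u = lam * (1 - 1 / (1 + u))"
      using u1 by (simp_all add: lam_def divide_simps power2_eq_square)
    then show "site_op q u x (\<lambda>_. 1) k = lam * pmf (bernoulli_pmf (1 / (1 + u))) x * 1" for k
      using u1 by (cases x) (simp_all add: site_op_def algebra_simps)
  qed
  have w: "weight b q u (\<lambda>_. 1) \<zeta> = (\<Prod>x\<in>{1..b}. lam * pmf (bernoulli_pmf (1 / (1 + u))) (\<zeta> x))" for b
  proof (induction b)
    case (Suc b)
    have "weight (Suc b) q u (\<lambda>_. 1) \<zeta>
        = lam * pmf (bernoulli_pmf (1 / (1 + u))) (\<zeta> (Suc b)) * weight b q u (\<lambda>_. 1) \<zeta>"
      unfolding weight_Suc site by (rule weight_scale)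
    with Suc show ?case by (simp add: prod.nat_ivl_Suc')
  qed (simp add: weight_0)
  have "pmf (Ber {1..b} (1 / (1 + u))) \<zeta> = (\<Prod>x\<in>{1..b}. pmf (bernoulli_pmf (1 / (1 + u))) (\<zeta> x))"
    unfolding Ber_def by (rule pmf_Pi') (use \<zeta> in \<open>auto simp: configs_def PiE_dflt_def\<close>)
  then show ?thesis
    unfolding w prod.distrib using lam_pos by simp
qed

text \<open>
  The marginal has the Bernoulli form except that the boundary vector is \<open>g / Z\<close>, with \<open>g\<close> the
  function obtained after \<open>n\<close> steps, in place of 1. Positivity of the operators bounds the \<open>L\<^sup>1\<close>
  distance of the two measures by the expectation of \<open>\<bar>g - Z\<bar> / \<bar>Z\<bar>\<close> after \<open>b\<close> steps of the chain from
  0, and the domination by \<open>\<pi>\<close> removes the dependence on \<open>b\<close>.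
\<close>
lemma tv_dist_prefix_le:
  assumes N: "b + n \<ge> 1"
    and rates: "\<alpha> > 0" "\<beta> > 0" "\<alpha> * (1 + u) = 1 - q" "\<beta> * (1 + v) = 1 - q" and v: "\<bar>v\<bar> < u"
    and stat: "asep_stationary (b + n) q \<alpha> \<beta> \<mu>"
  defines "f \<equiv> \<lambda>k. (u * v) ^ k"
  assumes Z: "(step ^^ (b + n)) f 0 \<noteq> 0"
  shows "tv_dist (configs {1..b}) (marginal {1..b} \<mu>) (Ber {1..b} (1 / (1 + u)))
      \<le> mass (\<lambda>k. \<bar>(step ^^ n) f k - mean f\<bar>) / \<bar>(step ^^ (b + n)) f 0\<bar>"
proof -
  define Z where "Z = (step ^^ (b + n)) f 0"
  define g where "g = (step ^^ n) f"
  define E where "E = mass (\<lambda>k. \<bar>g k - mean f\<bar>)"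
  have Z0: "Z \<noteq> 0" using Z by (simp add: Z_def)
  have "\<bar>u * v\<bar> < u\<^sup>2" using v u0 by (simp add: abs_mult power2_eq_square)
  then have f: "L1 f" unfolding f_def by (rule L1_power)
  then have g: "L1 g" unfolding g_def by (rule L1_steps)
  then have gm: "L1 (\<lambda>k. \<bar>g k - mean f\<bar>)" by (simp add: L1_abs L1_diff L1_const)
  from stat have set: "set_pmf \<mu> \<subseteq> configs {1..b + n}" by (simp add: asep_stationary_def)
  have null: "signed_stationary (b + n) q \<alpha> \<beta> (weight (b + n) q u f)"
    unfolding f_def by (rule weight_signed_stationary) (use N rates u0 in auto)
  have total: "lam ^ (b + n) * Z = (\<Sum>\<eta>\<in>configs {1..b + n}. weight (b + n) q u f \<eta>)"
    unfolding sum_weight Z_def ..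
  have total0: "lam ^ (b + n) * Z \<noteq> 0" using lam_pos Z0 by simp
  have \<mu>: "pmf \<mu> \<eta> = weight (b + n) q u f \<eta> / (lam ^ (b + n) * Z)" if "\<eta> \<in> configs {1..b + n}" for \<eta>
    by (rule stationary_eq_weights[OF N q0 less_imp_le[OF rates(1)] rates(2) stat null total total0 that])
  have marg: "pmf (marginal {1..b} \<mu>) \<zeta> = weight b q u g \<zeta> / (lam ^ b * Z)" if \<zeta>: "\<zeta> \<in> configs {1..b}" for \<zeta>
  proof -
    have "pmf (marginal {1..b} \<mu>) \<zeta>
        = (\<Sum>\<eta> | \<eta> \<in> configs {1..b + n} \<and> (\<lambda>x. if x \<in> {1..b} then \<eta> x else False) = \<zeta>.
             weight (b + n) q u f \<eta> / (lam ^ (b + n) * Z))"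
      unfolding marginal_def pmf_map_finite[OF finite_configs[OF finite_atLeastAtMost] set]
      by (intro sum.cong) (auto simp: \<mu>)
    also have "\<dots> = lam ^ n * weight b q u g \<zeta> / (lam ^ (b + n) * Z)"
      unfolding sum_divide_distrib[symmetric] sum_weight_extensions[OF \<zeta>] g_def ..
    also have "\<dots> = weight b q u g \<zeta> / (lam ^ b * Z)"
      using lam_pos by (simp add: power_add)
    finally show ?thesis .
  qed
  have Zg: "Z = (step ^^ b) g 0" by (simp add: Z_def g_def funpow_add)
  \<comment> \<open>The normalisation is the average of \<open>g\<close> after \<open>b\<close> further steps, so it is as close to the mean as \<open>g\<close> is.\<close>
  have "Z - mean f = (step ^^ b) (\<lambda>k. g k - mean f) 0"
    unfolding steps_diff steps_const Zg ..
  then have "\<bar>Z - mean f\<bar> \<le> (step ^^ b) (\<lambda>k. \<bar>g k - mean f\<bar>) 0"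
    using steps_abs[of b "\<lambda>k. g k - mean f" 0] by simp
  also have "\<dots> \<le> E"
    unfolding E_def by (rule steps_0_le_mass[OF gm]) simp
  finally have ZE: "\<bar>Z - mean f\<bar> \<le> E" .
  have "(\<Sum>\<zeta>\<in>configs {1..b}. \<bar>pmf (marginal {1..b} \<mu>) \<zeta> - pmf (Ber {1..b} (1 / (1 + u))) \<zeta>\<bar>)
      \<le> (\<Sum>\<zeta>\<in>configs {1..b}. weight b q u (\<lambda>k. \<bar>g k - Z\<bar>) \<zeta> / (lam ^ b * \<bar>Z\<bar>))"
  proof (rule sum_mono)
    fix \<zeta> assume \<zeta>: "\<zeta> \<in> configs {1..b}"
    have "pmf (marginal {1..b} \<mu>) \<zeta> - pmf (Ber {1..b} (1 / (1 + u))) \<zeta>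
        = (1 * weight b q u g \<zeta> + (- Z) * weight b q u (\<lambda>_. 1) \<zeta>) / (lam ^ b * Z)"
      unfolding marg[OF \<zeta>] pmf_Ber_weight[OF \<zeta>] using lam_pos Z0 by (simp add: field_simps)
    also have "\<dots> = weight b q u (\<lambda>k. g k - Z) \<zeta> / (lam ^ b * Z)"
      unfolding weight_linear[symmetric] by simp
    finally show "\<bar>pmf (marginal {1..b} \<mu>) \<zeta> - pmf (Ber {1..b} (1 / (1 + u))) \<zeta>\<bar>
        \<le> weight b q u (\<lambda>k. \<bar>g k - Z\<bar>) \<zeta> / (lam ^ b * \<bar>Z\<bar>)"
      using weight_abs[of b "\<lambda>k. g k - Z" \<zeta>] lam_pos
      by (simp add: abs_mult divide_right_mono)
  qed
  also have "\<dots> = (step ^^ b) (\<lambda>k. \<bar>g k - Z\<bar>) 0 / \<bar>Z\<bar>"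
    unfolding sum_divide_distrib[symmetric] sum_weight using lam_pos by simp
  also have "\<dots> \<le> (2 * E) / \<bar>Z\<bar>"
  proof (rule divide_right_mono)
    have "(step ^^ b) (\<lambda>k. \<bar>g k - Z\<bar>) 0 \<le> (step ^^ b) (\<lambda>k. \<bar>g k - mean f\<bar> - - \<bar>Z - mean f\<bar>) 0"
      by (rule steps_mono) simp
    also have "\<dots> = (step ^^ b) (\<lambda>k. \<bar>g k - mean f\<bar>) 0 + \<bar>Z - mean f\<bar>"
      unfolding steps_diff steps_const by simp
    also have "(step ^^ b) (\<lambda>k. \<bar>g k - mean f\<bar>) 0 \<le> E"
      unfolding E_def by (rule steps_0_le_mass[OF gm]) simp
    finally show "(step ^^ b) (\<lambda>k. \<bar>g k - Z\<bar>) 0 \<le> 2 * E" using ZE by simp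
  qed simp
  finally show ?thesis
    by (simp add: tv_dist_def E_def g_def Z_def mult.commute[of _ 2])
qed

text \<open>
  The normalisation converges to the mean of the boundary vector, which is positive, and the numerator
  tends to 0 with the distance \<open>N - b N\<close> to the right end. The two relations between the rates and
  \<open>u\<close>, \<open>v\<close> are the boundary conditions of the matrix product; \<open>\<bar>v\<bar> < u\<close> makes the boundary vector
  integrable.
\<close>
lemma tv_dist_prefix_tendsto_0:
  assumes rates: "\<alpha> > 0" "\<beta> > 0" "\<alpha> * (1 + u) = 1 - q" "\<beta> * (1 + v) = 1 - q" and v: "\<bar>v\<bar> < u"
    and stat: "\<And>N. N \<ge> 1 \<Longrightarrow> asep_stationary N q \<alpha> \<beta> (\<mu> N)"
    and b: "\<And>N. N \<ge> 1 \<Longrightarrow> b N \<le> N" and bulk: "filterlim (\<lambda>N. N - b N) at_top sequentially"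
  shows "(\<lambda>N. tv_dist (configs {1..b N}) (marginal {1..b N} (\<mu> N)) (Ber {1..b N} (1 / (1 + u)))) \<longlonglongrightarrow> 0"
proof -
  define f where "f = (\<lambda>k. (u * v) ^ k)"
  define e where "e n = mass (\<lambda>k. \<bar>(step ^^ n) f k - mean f\<bar>)" for n
  define Z where "Z N = (step ^^ N) f 0" for N
  have uv: "\<bar>u * v\<bar> < u\<^sup>2" using v u0 by (simp add: abs_mult power2_eq_square)
  then have f: "L1 f" unfolding f_def by (rule L1_power)
  have mean: "mean f > 0" unfolding f_def by (rule mean_power_pos[OF uv])
  have e0: "e \<longlonglongrightarrow> 0" unfolding e_def by (rule ergodic[OF f])
  have "(\<lambda>N. Z N - mean f) \<longlonglongrightarrow> 0"
  proof (rule Lim_null_comparison[OF _ e0], rule always_eventually, rule allI)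
    fix N
    have "L1 (\<lambda>k. \<bar>(step ^^ N) f k - mean f\<bar>)"
      by (simp add: L1_abs L1_diff L1_steps[OF f] L1_const)
    from nonneg_le_mass[OF this] show "norm (Z N - mean f) \<le> e N"
      by (simp add: Z_def e_def)
  qed
  then have Zlim: "Z \<longlonglongrightarrow> mean f" by (rule LIM_zero_cancel)
  have "(\<lambda>N. e (N - b N)) \<longlonglongrightarrow> 0"
    using filterlim_compose[OF e0 bulk] .
  then have "(\<lambda>N. e (N - b N) / \<bar>Z N\<bar>) \<longlonglongrightarrow> 0 / \<bar>mean f\<bar>"
    by (intro tendsto_divide tendsto_rabs Zlim) (use mean in auto)
  then have lim: "(\<lambda>N. e (N - b N) / \<bar>Z N\<bar>) \<longlonglongrightarrow> 0" by simp
  have "\<forall>\<^sub>F N in sequentially. Z N > 0"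
    using order_tendstoD(1)[OF Zlim mean] .
  then have "\<forall>\<^sub>F N in sequentially.
      norm (tv_dist (configs {1..b N}) (marginal {1..b N} (\<mu> N)) (Ber {1..b N} (1 / (1 + u))))
        \<le> e (N - b N) / \<bar>Z N\<bar>"
    using eventually_ge_at_top[of 1]
  proof eventually_elim
    case (elim N)
    have N: "b N + (N - b N) = N" using b elim by simp
    have "tv_dist (configs {1..b N}) (marginal {1..b N} (\<mu> N)) (Ber {1..b N} (1 / (1 + u)))
        \<le> e (N - b N) / \<bar>Z N\<bar>"
      using tv_dist_prefix_le[of "b N" "N - b N" \<alpha> \<beta> v "\<mu> N"] rates v stat elim
      unfolding N f_def[symmetric] e_def Z_def by auto
    then show ?case unfolding real_norm_def abs_of_nonneg[OF tv_dist_nonneg] .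
  qed
  then show ?thesis by (rule Lim_null_comparison[OF _ lim])
qed

end

section \<open>Particle-hole reflection\<close>

text \<open>
  Particle-hole exchange combined with space reversal. It interchanges the two reservoirs and so
  turns the high density phase into the low density one.
\<close>
definition reflect :: "nat \<Rightarrow> (nat \<Rightarrow> bool) \<Rightarrow> nat \<Rightarrow> bool" where
  "reflect N \<eta> x \<longleftrightarrow> x \<in> {1..N} \<and> \<not> \<eta> (Suc N - x)"

lemma reflect_configs: "reflect N \<eta> \<in> configs {1..N}"
  by (auto simp: reflect_def configs_def PiE_dflt_def)

lemma asep_gen_reflect:
  assumes N: "N \<ge> 1"
  shows "asep_gen N q \<beta> \<alpha> f (reflect N \<eta>) = asep_gen N q \<alpha> \<beta> (\<lambda>\<zeta>. f (reflect N \<zeta>)) \<eta>"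
proof -
  let ?r = "reflect N \<eta>"
  \<comment> \<open>The bond from \<open>x\<close> to \<open>x + 1\<close> is reflected to the bond from \<open>N - x\<close> to \<open>N - x + 1\<close>.\<close>
  have sw: "swap_sites (N - x) (N - x + 1) ?r = reflect N (swap_sites x (x + 1) \<eta>)" if "x \<in> {1..<N}" for x
    using that by (intro ext) (auto simp: swap_sites_def reflect_def)
  have flips: "flip_site 1 ?r = reflect N (flip_site N \<eta>)" "flip_site N ?r = reflect N (flip_site 1 \<eta>)"
    using N by (intro ext; auto simp: flip_site_def reflect_def)+
  have occs: "occ ?r (N - x) = 1 - occ \<eta> (x + 1)" "occ ?r (N - x + 1) = 1 - occ \<eta> x" if "x \<in> {1..<N}" for x
    using that by (auto simp: occ_def reflect_def Suc_diff_le)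
  have ends: "occ ?r 1 = 1 - occ \<eta> N" "occ ?r N = 1 - occ \<eta> 1"
    using N by (auto simp: occ_def reflect_def)
  have "(\<Sum>x\<in>{1..<N}. (occ ?r x * (1 - occ ?r (x + 1)) + q * occ ?r (x + 1) * (1 - occ ?r x))
            * (f (swap_sites x (x + 1) ?r) - f ?r))
      = (\<Sum>x\<in>{1..<N}. (occ ?r (N - x) * (1 - occ ?r (N - x + 1)) + q * occ ?r (N - x + 1) * (1 - occ ?r (N - x)))
            * (f (swap_sites (N - x) (N - x + 1) ?r) - f ?r))"
    by (rule sum.reindex_bij_witness[of _ "\<lambda>x. N - x" "\<lambda>x. N - x"]) auto
  also have "\<dots> = (\<Sum>x\<in>{1..<N}. (occ \<eta> x * (1 - occ \<eta> (x + 1)) + q * occ \<eta> (x + 1) * (1 - occ \<eta> x))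
            * (f (reflect N (swap_sites x (x + 1) \<eta>)) - f ?r))"
    by (intro sum.cong refl) (simp only: sw occs, simp add: mult_ac)
  finally show ?thesis
    unfolding asep_gen_def ends flips by simp
qed

lemma asep_stationary_reflect:
  assumes N: "N \<ge> 1" and stat: "asep_stationary N q \<alpha> \<beta> \<mu>"
  shows "asep_stationary N q \<beta> \<alpha> (map_pmf (reflect N) \<mu>)"
  using stat unfolding asep_stationary_iff_gen[OF N]
  by (auto simp: asep_gen_reflect[OF N] reflect_configs[simplified])

lemma map_pmf_Not_bernoulli:
  assumes "0 \<le> p" "p \<le> 1"
  shows "map_pmf Not (bernoulli_pmf p) = bernoulli_pmf (1 - p)"
proof (rule pmf_eqI)
  fix x
  have "inj Not" by (rule injI) simp
  then have "pmf (map_pmf Not (bernoulli_pmf p)) (\<not> \<not> x) = pmf (bernoulli_pmf p) (\<not> x)"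
    by (rule pmf_map_inj')
  then show "pmf (map_pmf Not (bernoulli_pmf p)) x = pmf (bernoulli_pmf (1 - p)) x"
    using assms by (cases x) auto
qed

lemma Ber_reflect:
  assumes ab: "1 \<le> a" "a \<le> b" "b \<le> N" and p: "0 \<le> p" "p \<le> 1"
  shows "Ber {a..b} (1 - p)
    = map_pmf (\<lambda>\<zeta> x. x \<in> {a..b} \<and> \<not> \<zeta> (Suc N - x)) (Ber {1..Suc N - a} p)"
proof -
  let ?I = "{a..b}" and ?J = "{Suc N - b..Suc N - a}" and ?h = "\<lambda>x. Suc N - x"
  have bij: "bij_betw ?h ?I ?J"
    by (rule bij_betw_byWitness[of _ ?h]) (use ab in auto)
  have out: "?h x \<notin> ?J" if "x \<notin> ?I" for x
    using that ab by auto
  have "Ber ?I (1 - p) = Pi_pmf ?I False (\<lambda>_. map_pmf Not (bernoulli_pmf p))"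
    by (simp add: Ber_def map_pmf_Not_bernoulli p)
  \<comment> \<open>Negation turns the default value off the interval into True, so it has to be reset afterwards.\<close>
  also have "\<dots> = map_pmf (\<lambda>f x. if x \<in> ?I then f x else False)
      (Pi_pmf ?I True (\<lambda>_. map_pmf Not (bernoulli_pmf p)))"
    by (rule Pi_pmf_default_swap[symmetric]) simp
  also have "Pi_pmf ?I True (\<lambda>_. map_pmf Not (bernoulli_pmf p))
      = map_pmf (\<lambda>\<zeta>. Not \<circ> \<zeta>) (Pi_pmf ?I False (\<lambda>_. bernoulli_pmf p))"
    by (rule Pi_pmf_map) auto
  also have "Pi_pmf ?I False (\<lambda>_. bernoulli_pmf p)
      = map_pmf (\<lambda>\<zeta>. \<zeta> \<circ> ?h) (Pi_pmf ?J False (\<lambda>_. bernoulli_pmf p))"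
    by (rule Pi_pmf_bij_betw[OF _ bij out]) auto
  also have "Pi_pmf ?J False (\<lambda>_. bernoulli_pmf p)
      = map_pmf (\<lambda>\<zeta> x. if x \<in> ?J then \<zeta> x else False) (Ber {1..Suc N - a} p)"
    unfolding Ber_def by (rule Pi_pmf_subset) (use ab in auto)
  finally show ?thesis
    unfolding pmf.map_comp
    by (rule trans) (intro map_pmf_cong refl ext, use ab in auto)
qed

lemma marginal_reflect:
  assumes ab: "1 \<le> a" "a \<le> b" "b \<le> N"
  shows "marginal {a..b} \<mu> = map_pmf (\<lambda>\<zeta> x. x \<in> {a..b} \<and> \<not> \<zeta> (Suc N - x))
           (marginal {1..Suc N - a} (map_pmf (reflect N) \<mu>))"
  unfolding marginal_def pmf.map_comp
  by (intro map_pmf_cong refl ext) (use ab in \<open>auto simp: reflect_def\<close>)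

lemma marginal_subset: "I \<subseteq> J \<Longrightarrow> marginal I \<mu> = map_pmf (\<lambda>\<zeta> x. if x \<in> I then \<zeta> x else False) (marginal J \<mu>)"
  unfolding marginal_def pmf.map_comp by (intro map_pmf_cong refl ext) auto

section \<open>The low and high density phases in the fan region\<close>

theorem theorem1p3:
  fixes q \<alpha> \<beta> u v :: real
    and a b :: "nat \<Rightarrow> nat"
    and \<mu> :: "nat \<Rightarrow> (nat \<Rightarrow> bool) pmf"
  assumes q: "0 \<le> q" "q < 1"
    and ab_pos: "\<alpha> > 0" "\<beta> > 0"
    and u: "u = (1 - q) / \<alpha> - 1"
    and v: "v = (1 - q) / \<beta> - 1"
    and stationary: "\<And>N. N \<ge> 1 \<Longrightarrow> asep_stationary N q \<alpha> \<beta> (\<mu> N)"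
    and interval: "\<And>N. N \<ge> 1 \<Longrightarrow> 1 \<le> a N \<and> a N \<le> b N \<and> b N \<le> N"
    and bulk: "much_greater (\<lambda>N. min (real (a N)) (real N - real (b N))) (\<lambda>_. 1)"
  shows
    "(u * v \<le> 1 \<and> u > max 1 v \<longrightarrow>
        (\<lambda>N. tv_dist (configs {a N..b N})
               (marginal {a N..b N} (\<mu> N)) (Ber {a N..b N} (\<alpha> / (1 - q))))
          \<longlonglongrightarrow> 0) \<and>
     (u * v \<le> 1 \<and> v > max 1 u \<longrightarrow>
        (\<lambda>N. tv_dist (configs {a N..b N})
               (marginal {a N..b N} (\<mu> N)) (Ber {a N..b N} (1 - \<beta> / (1 - q))))
          \<longlonglongrightarrow> 0)"
proof -
  have rates: "\<alpha> * (1 + u) = 1 - q" "\<beta> * (1 + v) = 1 - q"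
    using ab_pos by (simp_all add: u v)
  have densities: "\<alpha> / (1 - q) = 1 / (1 + u)" "\<beta> / (1 - q) = 1 / (1 + v)"
    using ab_pos q by (simp_all add: u v)
  have gt: "u > -1" "v > -1" using ab_pos q by (simp_all add: u v)
  have "(\<lambda>N. ereal (min (real (a N)) (real N - real (b N)))) \<longlonglongrightarrow> \<infinity>"
    using bulk unfolding much_greater_def liminf_PInfty by simp
  then have large: "\<forall>\<^sub>F N in sequentially. real C < min (real (a N)) (real N - real (b N))" for C :: nat
    by (subst less_ereal.simps(1)[symmetric], rule order_tendstoD(1)) simp
  have right: "filterlim (\<lambda>N. N - b N) at_top sequentially"
    unfolding filterlim_at_top
  proof
    show "\<forall>\<^sub>F N in sequentially. C \<le> N - b N" for C
      using large[of C] by eventually_elim auto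
  qed
  \<comment> \<open>In the reflected system the relevant interval starts at 1 and ends at \<open>Suc N - a N\<close>.\<close>
  have left: "filterlim (\<lambda>N. N - (Suc N - a N)) at_top sequentially"
    unfolding filterlim_at_top
  proof
    show "\<forall>\<^sub>F N in sequentially. C \<le> N - (Suc N - a N)" for C
      using large[of "Suc C"] eventually_ge_at_top[of 1]
    proof eventually_elim
      case (elim N)
      then show ?case using interval[of N] by auto
    qed
  qed
  show ?thesis
  proof (intro conjI impI)
    assume "u * v \<le> 1 \<and> u > max 1 v"
    then have u1: "1 < u" and vu: "\<bar>v\<bar> < u" using gt by auto
    interpret hidden_chain q u by unfold_locales (use q u1 in auto)
    let ?I = "\<lambda>N. {a N..b N}" and ?J = "\<lambda>N. {1..b N}"
    have lim: "(\<lambda>N. tv_dist (configs (?J N)) (marginal (?J N) (\<mu> N)) (Ber (?J N) (1 / (1 + u)))) \<longlonglongrightarrow> 0"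
      by (rule tv_dist_prefix_tendsto_0[OF ab_pos rates vu stationary _ right]) (use interval in auto)
    show "(\<lambda>N. tv_dist (configs (?I N)) (marginal (?I N) (\<mu> N)) (Ber (?I N) (\<alpha> / (1 - q)))) \<longlonglongrightarrow> 0"
    proof (rule Lim_null_comparison[OF _ lim])
      show "\<forall>\<^sub>F N in sequentially. norm (tv_dist (configs (?I N)) (marginal (?I N) (\<mu> N)) (Ber (?I N) (\<alpha> / (1 - q))))
          \<le> tv_dist (configs (?J N)) (marginal (?J N) (\<mu> N)) (Ber (?J N) (1 / (1 + u)))"
        using eventually_ge_at_top[of 1]
      proof eventually_elim
        case (elim N)
        have sub: "?I N \<subseteq> ?J N" using interval[OF elim] by auto
        have ber: "Ber (?I N) \<rho> = map_pmf (\<lambda>\<zeta> x. if x \<in> ?I N then \<zeta> x else False) (Ber (?J N) \<rho>)" for \<rho>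
          unfolding Ber_def by (rule Pi_pmf_subset[OF _ sub]) simp
        show ?case
          unfolding real_norm_def abs_of_nonneg[OF tv_dist_nonneg] marginal_subset[OF sub] ber densities
          by (rule tv_dist_map_le) (auto simp: finite_configs intro!: set_pmf_marginal set_pmf_Ber del: subsetI)
      qed
    qed
  next
    assume "u * v \<le> 1 \<and> v > max 1 u"
    then have v1: "1 < v" and uv: "\<bar>u\<bar> < v" using gt by auto
    interpret hidden_chain q v by unfold_locales (use q v1 in auto)
    let ?\<nu> = "\<lambda>N. map_pmf (reflect N) (\<mu> N)"
    have length: "Suc N - a N \<le> N" if "N \<ge> 1" for N
      using conjunct1[OF interval[OF that]] by arith
    have stationary': "asep_stationary N q \<beta> \<alpha> (?\<nu> N)" if "N \<ge> 1" for N
      using asep_stationary_reflect[OF that stationary[OF that]] .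
    let ?I = "\<lambda>N. {a N..b N}" and ?J = "\<lambda>N. {1..Suc N - a N}"
    have lim: "(\<lambda>N. tv_dist (configs (?J N)) (marginal (?J N) (?\<nu> N)) (Ber (?J N) (1 / (1 + v)))) \<longlonglongrightarrow> 0"
      by (rule tv_dist_prefix_tendsto_0[OF ab_pos(2,1) rates(2,1) uv stationary' _ left]) (erule length | assumption)+
    show "(\<lambda>N. tv_dist (configs (?I N)) (marginal (?I N) (\<mu> N)) (Ber (?I N) (1 - \<beta> / (1 - q)))) \<longlonglongrightarrow> 0"
    proof (rule Lim_null_comparison[OF _ lim])
      show "\<forall>\<^sub>F N in sequentially. norm (tv_dist (configs (?I N)) (marginal (?I N) (\<mu> N)) (Ber (?I N) (1 - \<beta> / (1 - q))))
          \<le> tv_dist (configs (?J N)) (marginal (?J N) (?\<nu> N)) (Ber (?J N) (1 / (1 + v)))"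
        using eventually_ge_at_top[of 1]
      proof eventually_elim
        case (elim N)
        then have ab: "1 \<le> a N" "a N \<le> b N" "b N \<le> N" using interval[of N] by auto
        have p: "0 \<le> 1 / (1 + v)" "1 / (1 + v) \<le> 1" using v1 by auto
        show ?case
          unfolding real_norm_def abs_of_nonneg[OF tv_dist_nonneg] marginal_reflect[OF ab] densities Ber_reflect[OF ab p]
          by (rule tv_dist_map_le) (auto simp: finite_configs intro!: set_pmf_marginal set_pmf_Ber del: subsetI)
      qed
    qed
  qed
qed

end
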